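(* Let $k\ge 1$ be an integer, let $\mathbf Z$ be a standard normal random vector in $\mathbb R^k$, and suppose that a set $A\subseteq\mathbb R^k$ is Schur$^2$-convex. Let $P(\mathbf x):=\mathsf P(\mathbf Z\in A+\mathbf x)$ for $\mathbf x\in\mathbb R^k$. (I) Then the function $\mathbb R^k\ni\mathbf x\mapsto P(\mathbf x)$ is Schur$^2$-concave. (II) Moreover, the function $P$ is strictly Schur$^2$-concave unless $A$ is equivalent to a spherically symmetric set.
   Context: Standard normal in $\mathbb R^k$: zero mean and identity covariance matrix. Majorization: for $\mathbf a,\mathbf b\in\mathbb R^k$, $\mathbf a\succeq\mathbf b$ (equivalently $\mathbf b\preceq\mathbf a$) means $a_1+\dots+a_k=b_1+\dots+b_k$ and $a_{[1]}+\dots+a_{[j]}\ge b_{[1]}+\dots+b_{[j]}$ for all $j\in\{1,\dots,k\}$, where $a_{[1]}\ge\dots\ge a_{[k]}$ are the numbers $a_1,\dots,a_k$ in nonincreasing order. Let $\mathbf a_\downarrow:=(a_{[1]},\dots,a_{[k]})$. Write $\mathbf a\succ\mathbf b$ if $\mathbf a\succeq\mathbf b$ and $\mathbf a_\downarrow\ne\mathbf b_\downarrow$. For $E\subseteq\mathbb R^k$, a function $g\colon E\to[0,\infty]$ is Schur-concave if $g(\mathbf a)\le g(\mathbf b)$ whenever $\mathbf a,\mathbf b\in E$ and $\mathbf a\succeq\mathbf b$. It is strictly Schur-concave if for all $\mathbf a,\mathbf b\in E$ with $\mathbf a\succ\mathbf b$ one has $g(\mathbf a)<g(\mathbf b)$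 or $g(\mathbf a)=g(\mathbf b)=\infty$. A Lebesgue-measurable function $f\colon\mathbb R^k\to[0,\infty]$ is (strictly) Schur$^2$-concave if there is a (strictly) Schur-concave function $g\colon[0,\infty)^k\to[0,\infty]$ with $f(x_1,\dots,x_k)=g(x_1^2,\dots,x_k^2)$ for all $(x_1,\dots,x_k)\in\mathbb R^k$. A (Lebesgue-measurable) set $A\subseteq\mathbb R^k$ is Schur$^2$-convex if its indicator function is Schur$^2$-concave; that is, writing $\mathbf x^2:=(x_1^2,\dots,x_k^2)$, if the conditions $\mathbf x\in A$, $\mathbf y\in\mathbb R^k$, and $\mathbf y^2\preceq\mathbf x^2$ imply $\mathbf y\in A$. A measurable set is spherically symmetric if its indicator is constant on each Euclidean sphere $\{\mathbf x\in\mathbb R^k\colon\|\mathbf x\|=r\}$, $r\in(0,\infty)$. Two measurable sets are equivalent if their indicators are equal Lebesgue-almost everywhere. *)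

theory Defs
  imports "HOL-Probability.Probability"
begin

text \<open>
  The dimension is \<open>k = CARD('n)\<close>, so \<open>k \<ge> 1\<close> holds automatically.
\<close>

definition decreasing_rearrangement :: "real^'n \<Rightarrow> real list" where
  "decreasing_rearrangement a =
     rev (sorted_list_of_multiset (image_mset (\<lambda>i. a $ i) (mset_set UNIV)))"

definition majorizes :: "real^'n \<Rightarrow> real^'n \<Rightarrow> bool" where
  "majorizes a b \<longleftrightarrow>
     (\<Sum>i\<in>UNIV. a $ i) = (\<Sum>i\<in>UNIV. b $ i) \<and>
     (\<forall>j\<in>{1..CARD('n)}.
        sum_list (take j (decreasing_rearrangement a)) \<ge> sum_list (take j (decreasing_rearrangement b)))"

definition strictly_majorizes :: "real^'n \<Rightarrow> real^'n \<Rightarrow> bool" where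
  "strictly_majorizes a b \<longleftrightarrow>
     majorizes a b \<and> decreasing_rearrangement a \<noteq> decreasing_rearrangement b"

definition schur_concave_on :: "(real^'n) set \<Rightarrow> (real^'n \<Rightarrow> ennreal) \<Rightarrow> bool" where
  "schur_concave_on E g \<longleftrightarrow> (\<forall>a\<in>E. \<forall>b\<in>E. majorizes a b \<longrightarrow> g a \<le> g b)"

definition strictly_schur_concave_on :: "(real^'n) set \<Rightarrow> (real^'n \<Rightarrow> ennreal) \<Rightarrow> bool" where
  "strictly_schur_concave_on E g \<longleftrightarrow>
     (\<forall>a\<in>E. \<forall>b\<in>E. strictly_majorizes a b \<longrightarrow> g a < g b \<or> (g a = \<infinity> \<and> g b = \<infinity>))"

definition nonneg_orthant :: "(real^'n) set" where
  "nonneg_orthant = {u. \<forall>i. 0 \<le> u $ i}"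

definition vec_square :: "real^'n \<Rightarrow> real^'n" where
  "vec_square x = (\<chi> i. (x $ i)\<^sup>2)"

text \<open>
  Only the values of \<open>g\<close> on the nonnegative orthant matter below, so a total \<open>g\<close>
  stands for a function with domain \<open>[0,\<infinity>)^k\<close>.
\<close>

definition schur2_concave :: "(real^'n \<Rightarrow> ennreal) \<Rightarrow> bool" where
  "schur2_concave f \<longleftrightarrow> f \<in> borel_measurable lebesgue \<and>
     (\<exists>g. schur_concave_on nonneg_orthant g \<and> (\<forall>x. f x = g (vec_square x)))"

definition strictly_schur2_concave :: "(real^'n \<Rightarrow> ennreal) \<Rightarrow> bool" where
  "strictly_schur2_concave f \<longleftrightarrow> f \<in> borel_measurable lebesgue \<and>
     (\<exists>g. strictly_schur_concave_on nonneg_orthant g \<and> (\<forall>x. f x = g (vec_square x)))"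

definition schur2_convex :: "(real^'n) set \<Rightarrow> bool" where
  "schur2_convex A \<longleftrightarrow> schur2_concave (indicator A)"

lemma schur2_convex_iff:
  fixes A :: "(real^'n) set"
  shows "schur2_convex A \<longleftrightarrow>
     A \<in> sets lebesgue \<and>
     (\<forall>x y. x \<in> A \<longrightarrow> majorizes (vec_square x) (vec_square y) \<longrightarrow> y \<in> A)"
proof
  assume "schur2_convex A"
  then obtain g where meas: "(indicator A :: _ \<Rightarrow> ennreal) \<in> borel_measurable lebesgue"
    and sc: "schur_concave_on nonneg_orthant g"
    and g: "\<And>x. (indicator A x :: ennreal) = g (vec_square x)"
    by (auto simp: schur2_convex_def schur2_concave_def)
  have "A \<in> sets lebesgue"
    using meas by (simp add: borel_measurable_indicator_iff)
  moreover have "y \<in> A" if "x \<in> A" "majorizes (vec_square x) (vec_square y)" for x y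
  proof -
    have "(indicator A x :: ennreal) \<le> indicator A y"
      using sc that(2) unfolding g
      by (auto simp: schur_concave_on_def nonneg_orthant_def vec_square_def)
    with that(1) show ?thesis
      by (cases "y \<in> A") auto
  qed
  ultimately show "A \<in> sets lebesgue \<and>
     (\<forall>x y. x \<in> A \<longrightarrow> majorizes (vec_square x) (vec_square y) \<longrightarrow> y \<in> A)"
    by blast
next
  assume A: "A \<in> sets lebesgue \<and>
     (\<forall>x y. x \<in> A \<longrightarrow> majorizes (vec_square x) (vec_square y) \<longrightarrow> y \<in> A)"
  define r :: "real^'n \<Rightarrow> real^'n" where "r u = (\<chi> i. sqrt (u $ i))" for u
  have r: "vec_square (r u) = u" if "u \<in> nonneg_orthant" for u
    using that by (simp add: r_def vec_square_def nonneg_orthant_def vec_eq_iff)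
  have refl: "majorizes u u" for u :: "real^'n"
    by (simp add: majorizes_def)
  have sq: "vec_square x \<in> nonneg_orthant" for x :: "real^'n"
    by (simp add: vec_square_def nonneg_orthant_def)
  have "schur_concave_on nonneg_orthant (\<lambda>u. indicator A (r u) :: ennreal)"
    using A r by (auto simp: schur_concave_on_def indicator_def)
  moreover have "(indicator A x :: ennreal) = indicator A (r (vec_square x))" for x
  proof -
    have "x \<in> A \<longleftrightarrow> r (vec_square x) \<in> A"
      using A r[OF sq] refl by metis
    then show ?thesis by (simp add: indicator_def)
  qed
  moreover have "(indicator A :: _ \<Rightarrow> ennreal) \<in> borel_measurable lebesgue"
    using A by (intro borel_measurable_indicator) blast
  ultimately show "schur2_convex A"
    unfolding schur2_convex_def schur2_concave_def by blast
qed

definition spherically_symmetric :: "(real^'n) set \<Rightarrow> bool" where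
  "spherically_symmetric A \<longleftrightarrow> A \<in> sets lebesgue \<and>
     (\<forall>r>0. (indicator A :: real^'n \<Rightarrow> real) constant_on sphere 0 r)"

definition equivalent_sets :: "(real^'n) set \<Rightarrow> (real^'n) set \<Rightarrow> bool" where
  "equivalent_sets A B \<longleftrightarrow> A \<in> sets lebesgue \<and> B \<in> sets lebesgue \<and>
     (AE x in lebesgue. (indicator A x :: real) = indicator B x)"

text \<open>The law \<open>N(0, I)\<close>: its density is the product of \<open>k\<close> univariate \<open>N(0, 1)\<close> densities.\<close>

definition standard_normal :: "'w measure \<Rightarrow> ('w \<Rightarrow> real^'n) \<Rightarrow> bool" where
  "standard_normal M Z \<longleftrightarrow>
     distributed M lborel Z (\<lambda>z. ennreal (\<Prod>i\<in>UNIV. std_normal_density (z $ i)))"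

text \<open>
  The probability that \<open>Z\<close> lies in \<open>A + x\<close>. As \<open>A\<close> is only Lebesgue measurable, this event
  need not belong to the sigma-algebra of \<open>M\<close>, but it belongs to that of its completion
  (which is \<open>M\<close> itself if \<open>M\<close> is complete).
\<close>

definition shifted_prob ::
    "'w measure \<Rightarrow> ('w \<Rightarrow> real^'n) \<Rightarrow> (real^'n) set \<Rightarrow> real^'n \<Rightarrow> ennreal" where
  "shifted_prob M Z A x =
     emeasure (completion M) {w \<in> space M. Z w \<in> (\<lambda>a. a + x) ` A}"

lemma shifted_event_measurable:
  fixes Z :: "'w \<Rightarrow> real^'n"
  assumes "standard_normal M Z" "A \<in> sets lebesgue"
  shows "{w \<in> space M. Z w \<in> (\<lambda>a. a + x) ` A} \<in> sets (completion M)"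
proof -
  have d: "distributed M lborel Z (\<lambda>z. ennreal (\<Prod>i\<in>UNIV. std_normal_density (z $ i)))"
    using assms(1) by (simp add: standard_normal_def)
  have Z: "Z \<in> measurable M lborel"
    using d by (rule distributed_measurable)
  have img: "(\<lambda>a. a + x) ` A \<in> sets lebesgue"
    using lebesgue_sets_translation[OF assms(2), of x] by (simp add: add.commute)
  then obtain S N N' where S: "(\<lambda>a. a + x) ` A = S \<union> N" "N \<subseteq> N'" "N' \<in> null_sets lborel" "S \<in> sets lborel"
    by (rule sets_completionE)
  have "emeasure (distr M lborel Z) N' = 0"
    unfolding distributed_distr_eq_density[OF d]
    using S(3) absolutely_continuousI_density[OF distributed_borel_measurable[OF d]]
    by (auto simp: absolutely_continuous_def)
  then have null: "Z -` N' \<inter> space M \<in> null_sets M"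
    using S(3) measurable_sets[OF Z, of N'] emeasure_distr[OF Z, of N']
    by (simp add: null_sets_def)
  have "{w \<in> space M. Z w \<in> (\<lambda>a. a + x) ` A} = (Z -` S \<inter> space M) \<union> (Z -` N \<inter> space M)"
    using S(1) by auto
  moreover have "Z -` N \<inter> space M \<subseteq> Z -` N' \<inter> space M"
    using S(2) by auto
  ultimately show ?thesis
    using null measurable_sets[OF Z S(4)] by (rule sets_completionI)
qed

end

theory Submission
  imports Defs
begin

text \<open>
  By the theorem of Hardy, Littlewood and Polya, majorization is generated by permutations and
  transfers between two coordinates. For vectors of squares, a transfer between the coordinates
  \<open>i\<close> and \<open>j\<close> rotates a point of the \<open>(i, j)\<close>-plane from an angle \<open>s\<close> to an angle \<open>t\<close> with
  \<open>0 \<le> s < t \<le> pi / 4\<close>. Let \<open>\<sigma>\<close> be the reflection exchanging these two angles. Symmetrizing the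
  difference of the Gaussian integrals over \<open>A\<close> by \<open>\<sigma>\<close> yields an integrand that is a product of
  \<open>1\<^sub>A - 1\<^sub>A \<circ> \<sigma>\<close> and a difference of sums of hyperbolic cosines, and both factors have the sign of
  \<open>sin (4 * \<theta> - 2 * (s + t))\<close> at a point of angle \<open>\<theta>\<close>. In case of equality \<open>A\<close> is almost everywhere
  \<open>\<sigma>\<close>-invariant. Passing to points of density turns this into exact invariance; on each circle
  the indicator is then monotone on \<open>[0, pi / 4]\<close>, even, and periodic with periods \<open>pi / 2\<close> and
  \<open>s + t\<close>, hence constant, and by permutation symmetry the density set is spherically symmetric.
\<close>

section \<open>Majorization and transfers\<close>

text \<open>The axis of \<open>\<sigma>\<close> lies at the angle \<open>(s + t) / 2\<close>,
  strictly between \<open>0\<close> and \<open>pi / 4\<close>. At these two end values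
  \<open>\<sigma>\<close> would be a signed permutation of the coordinates, under which every
  Schur-square-convex set is invariant anyway. In between, its invariance is genuine information,
  and a single plane with a single such angle settles the equality case.

  The obstacle is null sets. An identity that holds almost everywhere says nothing about a given
  circle. Fubini would yield it on almost every circle of one plane, with an exceptional set that
  depends on the plane, whereas points of a sphere are joined by moves along circles in several
  planes. The density set is defined point by point, and both the monotonicity along circles and the
  reflection invariance hold for it without exception.

  Strictness survives the passage to chains: a chain that changes the decreasing rearrangement
  contains a transfer, and every single transfer is strict unless \<open>A\<close> is equivalent to
  a spherically symmetric set. In dimension one there are no transfers, and strict majorization is
  impossible.\<close>

lemma decreasing_rearrangement_enum:
  fixes a :: "real^'n"
  obtains e where "bij_betw e {..<CARD('n)} UNIV"
    and "\<forall>j\<le>CARD('n). sum_list (take j (decreasing_rearrangement a)) = (\<Sum>i<j. a $ e i)"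
    and "\<forall>j<CARD('n). \<forall>i\<le>j. a $ e j \<le> a $ e i"
proof -
  obtain xs :: "'n list" where xs: "set xs = UNIV" "distinct xs"
    using finite_distinct_list[of "UNIV::'n set"] by auto
  \<comment> \<open>Sorting the indices by their values, rather than the values, retains which
    coordinate each entry comes from.\<close>
  define ys where "ys = rev (sort_key (($) a) xs)"
  have ys: "set ys = UNIV" "distinct ys" "mset ys = mset_set UNIV"
    using xs mset_set_set[OF xs(2)] by (auto simp: ys_def)
  have len: "length ys = CARD('n)"
    using ys distinct_card by fastforce
  have "decreasing_rearrangement a = rev (sort (map (($) a) xs))"
    using mset_set_set[OF xs(2)] xs(1)
    by (simp add: decreasing_rearrangement_def flip: mset_map)
  also have "sort (map (($) a) xs) = map (($) a) (sort_key (($) a) xs)"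
    by (intro properties_for_sort) simp_all
  finally have dr: "decreasing_rearrangement a = map (($) a) ys"
    by (simp add: ys_def rev_map)
  have sorted: "sorted (rev (map (($) a) ys))"
    by (simp add: ys_def rev_map)
  show thesis
  proof (rule that[of "(!) ys"])
    show "bij_betw ((!) ys) {..<CARD('n)} UNIV"
      using bij_betw_nth[OF ys(2), of "{..<CARD('n)}" UNIV] len ys(1) by simp
    show "\<forall>j\<le>CARD('n). sum_list (take j (decreasing_rearrangement a)) = (\<Sum>i<j. a $ ys ! i)"
    proof safe
      fix j assume "j \<le> CARD('n)"
      then show "sum_list (take j (decreasing_rearrangement a)) = (\<Sum>i<j. a $ ys ! i)"
        unfolding dr using len
        by (subst sum_list_sum_nth) (auto simp: atLeast0LessThan min_def intro!: sum.cong)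
    qed
    show "\<forall>j<CARD('n). \<forall>i\<le>j. a $ ys ! j \<le> a $ ys ! i"
    proof safe
      fix i j assume "i \<le> j" "j < CARD('n)"
      then show "a $ ys ! j \<le> a $ ys ! i"
        using sorted_rev_nth_mono[OF sorted, of i j] len by simp
    qed
  qed
qed

text \<open>An exchange argument: with \<open>m = card I\<close>, as many elements of
  \<open>I\<close> lie at or above \<open>m\<close> as are missing below \<open>m\<close>, and
  \<open>f m\<close> separates the values on these two sets. The case \<open>m = n\<close> is apart
  because the antitonicity says nothing about \<open>f n\<close>.\<close>

lemma sum_antimono_le_initial:
  fixes f :: "nat \<Rightarrow> real"
  assumes "I \<subseteq> {..<n}" and anti: "\<And>i j. i \<le> j \<Longrightarrow> j < n \<Longrightarrow> f j \<le> f i"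
  shows "sum f I \<le> (\<Sum>i<card I. f i)"
proof -
  have fin: "finite I"
    using assms(1) finite_subset by blast
  define m where "m = card I"
  have m: "m \<le> n"
    using card_mono[OF _ assms(1)] by (simp add: m_def)
  have "sum f (I - {..<m}) \<le> sum f ({..<m} - I)"
  proof (cases "m < n")
    case True
    have "sum f (I - {..<m}) \<le> (\<Sum>i\<in>I - {..<m}. f m)"
      using assms True by (intro sum_mono anti) auto
    also have "\<dots> = (\<Sum>i\<in>{..<m} - I. f m)"
      using card_Diff_subset_Int[of I "{..<m}"] card_Diff_subset_Int[of "{..<m}" I] fin
      by (simp add: m_def Int_commute)
    also have "\<dots> \<le> sum f ({..<m} - I)"
      using assms True by (intro sum_mono anti) auto
    finally show ?thesis .
  next
    case False
    then have "I = {..<m}"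
      using m assms(1) by (intro card_subset_eq) (auto simp: m_def)
    then show ?thesis by simp
  qed
  then have "sum f (I \<inter> {..<m}) + sum f (I - {..<m}) \<le> sum f ({..<m} \<inter> I) + sum f ({..<m} - I)"
    by (simp add: Int_commute)
  then show ?thesis
    using fin by (simp add: m_def flip: sum.Int_Diff)
qed

text \<open>Together with \<open>decreasing_rearrangement_enum\<close>, this identifies the partial
  sums as maxima of sums over index sets of a given size. Majorization is checked in this
  form.\<close>

lemma sum_le_top_sum:
  fixes a :: "real^'n"
  shows "(\<Sum>i\<in>S. a $ i) \<le> sum_list (take (card S) (decreasing_rearrangement a))"
proof -
  obtain e where e: "bij_betw e {..<CARD('n)} UNIV"
    and top: "\<forall>j\<le>CARD('n). sum_list (take j (decreasing_rearrangement a)) = (\<Sum>i<j. a $ e i)"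
    and anti: "\<forall>j<CARD('n). \<forall>i\<le>j. a $ e j \<le> a $ e i"
    by (rule decreasing_rearrangement_enum[of a])
  define I where "I = {i. i < CARD('n) \<and> e i \<in> S}"
  have inj: "inj_on e I"
    using e by (auto simp: bij_betw_def I_def inj_on_def)
  have img: "e ` I = S"
    using e unfolding bij_betw_def I_def by (auto simp: image_iff set_eq_iff) (metis lessThan_iff)
  have "card I = card S"
    using card_image[OF inj] img by simp
  moreover have "card S \<le> CARD('n)"
    by (intro card_mono) auto
  moreover have "(\<Sum>i\<in>S. a $ i) = (\<Sum>i\<in>I. a $ e i)"
    using sum.reindex[OF inj, of "\<lambda>i. a $ i"] img by simp
  moreover have "(\<Sum>i\<in>I. a $ e i) \<le> (\<Sum>i<card I. a $ e i)"
    by (rule sum_antimono_le_initial[where n = "CARD('n)"]) (auto simp: I_def anti)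
  ultimately show ?thesis
    by (simp add: top)
qed

text \<open>By the description of partial sums as maxima, it suffices to find for each index set
  \<open>S\<close> a set \<open>T\<close> of the same size over which \<open>a\<close> sums to at
  least as much as \<open>b\<close> over \<open>S\<close>. If \<open>S\<close> contains both or
  neither of \<open>i\<close> and \<open>j\<close>, take \<open>T = S\<close>. Otherwise either
  \<open>S\<close> works, or \<open>S\<close> with \<open>i\<close> and \<open>j\<close> exchanged:
  neither \<open>b $ i\<close> nor \<open>b $ j\<close> exceeds the larger of \<open>a $ i\<close>
  and \<open>a $ j\<close>.\<close>

lemma majorizes_pairI:
  fixes a b :: "real^'n"
  assumes "i \<noteq> j" and off: "\<And>k. k \<noteq> i \<Longrightarrow> k \<noteq> j \<Longrightarrow> b $ k = a $ k"
    and s: "b $ i + b $ j = a $ i + a $ j" and d: "\<bar>b $ i - b $ j\<bar> \<le> \<bar>a $ i - a $ j\<bar>"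
  shows "majorizes a b"
proof -
  have "sum (($) c) UNIV = c $ i + c $ j + sum (($) c) (UNIV - {i, j})" for c :: "real^'n"
    using \<open>i \<noteq> j\<close> by (subst sum.subset_diff[of "{i, j}"]) auto
  moreover have "sum (($) b) (UNIV - {i, j}) = sum (($) a) (UNIV - {i, j})"
    by (rule sum.cong) (auto simp: off)
  ultimately have total: "sum (($) a) UNIV = sum (($) b) UNIV"
    using s by simp
  have main: "\<exists>T. card T = card S \<and> sum (($) b) S \<le> sum (($) a) T" for S
  proof -
    have swap: "\<exists>T. card T = card S \<and> sum (($) b) S \<le> sum (($) a) T"
      if uv: "u \<in> S" "v \<notin> S" "{u, v} = {i, j}" for u v
    proof -
      have bu: "b $ u \<le> a $ u \<or> b $ u \<le> a $ v"
        using uv(3) s d unfolding doubleton_eq_iff by (auto simp: abs_if split: if_splits)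
      have S: "sum (($) b) S = b $ u + sum (($) a) (S - {u})"
      proof -
        have "sum (($) b) (S - {u}) = sum (($) a) (S - {u})"
          using uv by (intro sum.cong off) (auto simp: doubleton_eq_iff)
        then show ?thesis
          using uv by (simp add: sum.remove)
      qed
      have Sa: "sum (($) a) S = a $ u + sum (($) a) (S - {u})"
        using uv by (simp add: sum.remove)
      have Sv: "sum (($) a) (insert v (S - {u})) = a $ v + sum (($) a) (S - {u})"
        using uv by simp
      have cv: "card (insert v (S - {u})) = card S"
        using uv by (metis Diff_iff card.remove card_insert_disjoint finite)
      show ?thesis
        using bu S Sa Sv cv by (metis add_le_cancel_right)
    qed
    consider "i \<in> S \<longleftrightarrow> j \<in> S" | "i \<in> S" "j \<notin> S" | "j \<in> S" "i \<notin> S" by blast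
    then show ?thesis
    proof cases
      case 1
      have "sum (($) b) S = sum (($) a) S"
      proof (cases "i \<in> S")
        case True
        then have "{i, j} \<subseteq> S" using 1 by simp
        then have "sum (($) c) S = c $ i + c $ j + sum (($) c) (S - {i, j})" for c :: "real^'n"
          using \<open>i \<noteq> j\<close> by (subst sum.subset_diff[of "{i, j}"]) auto
        moreover have "sum (($) b) (S - {i, j}) = sum (($) a) (S - {i, j})"
          by (rule sum.cong) (auto simp: off)
        ultimately show ?thesis using s by simp
      next
        case False
        then show ?thesis using 1 by (intro sum.cong off) auto
      qed
      then show ?thesis by auto
    next
      case 2
      then show ?thesis using swap[of i j] by simp
    next
      case 3
      then show ?thesis using swap[of j i] by (simp add: insert_commute)
    qed
  qed
  have "sum_list (take l (decreasing_rearrangement b)) \<le> sum_list (take l (decreasing_rearrangement a))"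
    if l: "l \<le> CARD('n)" for l
  proof -
    obtain e where e: "bij_betw e {..<CARD('n)} UNIV"
      and top: "\<forall>j\<le>CARD('n). sum_list (take j (decreasing_rearrangement b)) = (\<Sum>i<j. b $ e i)"
      and "\<forall>j<CARD('n). \<forall>i\<le>j. b $ e j \<le> b $ e i"
      by (rule decreasing_rearrangement_enum[of b])
    have inj: "inj_on e {..<l}"
      using e l by (auto simp: bij_betw_def inj_on_def)
    obtain T where T: "card T = card (e ` {..<l})" "sum (($) b) (e ` {..<l}) \<le> sum (($) a) T"
      using main by blast
    have "sum_list (take l (decreasing_rearrangement b)) = sum (($) b) (e ` {..<l})"
      using top[rule_format, OF l] by (simp add: sum.reindex[OF inj])
    also note T(2)
    also have "sum (($) a) T \<le> sum_list (take l (decreasing_rearrangement a))"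
      using sum_le_top_sum[of a T] T(1) by (simp add: card_image[OF inj])
    finally show ?thesis .
  qed
  then show ?thesis
    using total by (auto simp: majorizes_def)
qed

section \<open>The theorem of Hardy, Littlewood and Polya\<close>

lemma decreasing_rearrangement_permute:
  fixes a :: "real^'n"
  assumes "bij p"
  shows "decreasing_rearrangement (\<chi> i. a $ p i) = decreasing_rearrangement a"
proof -
  have "mset_set (UNIV :: 'n set) = image_mset p (mset_set UNIV)"
    using assms by (simp add: image_mset_mset_set bij_def)
  then have "image_mset (\<lambda>i. a $ i) (mset_set UNIV) = image_mset (\<lambda>i. a $ p i) (mset_set UNIV)"
    by (metis (no_types, lifting) image_mset.compositionality comp_def image_mset_cong)
  then show ?thesis
    by (simp add: decreasing_rearrangement_def)
qed

lemma sum_decreasing_rearrangement: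
  fixes a :: "real^'n"
  shows "(\<Sum>i\<in>UNIV. a $ i) = sum_list (decreasing_rearrangement a)"
  by (simp add: decreasing_rearrangement_def sum_mset_sum_list[symmetric] sum_unfold_sum_mset)

lemma majorizes_permute:
  fixes a :: "real^'n"
  assumes "bij p"
  shows "majorizes a (\<chi> i. a $ p i)"
  by (simp add: majorizes_def sum_decreasing_rearrangement decreasing_rearrangement_permute[OF assms]
      del: vec_lambda_beta)

text \<open>Known as a Robin Hood or Pigou-Dalton transfer when
  \<open>a $ j + d \<le> a $ i - d\<close>, the condition under which it is used: the two
  coordinates do not cross.\<close>

definition transfer :: "'n \<Rightarrow> 'n \<Rightarrow> real \<Rightarrow> real^'n \<Rightarrow> real^'n" where
  "transfer i j d a = (\<chi> k. if k = i then a $ i - d else if k = j then a $ j + d else a $ k)"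

text \<open>Induction on the number of coordinates in which \<open>a\<close> and \<open>b\<close>
  differ: a transfer from a surplus to the first deficit makes at least one more coordinate agree.
  Only \<open>b\<close> has to be ordered along \<open>e\<close>, so the intermediate vectors are
  never sorted again.\<close>

lemma transfer_chain_ordered:
  fixes a b :: "real^'n"
  assumes e: "bij_betw e {..<CARD('n)} UNIV"
    and anti: "\<And>i j. i \<le> j \<Longrightarrow> j < CARD('n) \<Longrightarrow> b $ e j \<le> b $ e i"
    and step: "\<And>a i j d. i \<noteq> j \<Longrightarrow> 0 < d \<Longrightarrow> a $ j + d \<le> a $ i - d \<Longrightarrow> R a (transfer i j d a)"
    and refl: "\<And>a. R a a"
    and trans: "\<And>a b c. R a b \<Longrightarrow> R b c \<Longrightarrow> R a c"
    and dom: "\<And>m. m \<le> CARD('n) \<Longrightarrow> (\<Sum>i<m. b $ e i) \<le> (\<Sum>i<m. a $ e i)"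
    and total: "(\<Sum>i<CARD('n). b $ e i) = (\<Sum>i<CARD('n). a $ e i)"
  shows "R a b"
  using dom total
proof (induction "card {k. a $ k \<noteq> b $ k}" arbitrary: a rule: less_induct)
  case less
  note dom = less.prems(1) and total = less.prems(2)
  let ?n = "CARD('n)"
  have ecase: "\<exists>i<?n. e i = k" for k
    using e by (metis UNIV_I bij_betw_imp_surj_on imageE lessThan_iff)
  have einj: "e i = e j \<longleftrightarrow> i = j" if "i < ?n" "j < ?n" for i j
    using e that by (auto simp: bij_betw_def inj_on_def)
  show ?case
  proof (cases "\<exists>k<?n. a $ e k < b $ e k")
    case False
    then have ge: "b $ e k \<le> a $ e k" if "k < ?n" for k
      using that by force
    have "a $ e i = b $ e i" if "i < ?n" for i
    proof (rule ccontr)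
      assume "a $ e i \<noteq> b $ e i"
      then have "b $ e i < a $ e i"
        using ge[OF that] by simp
      then have "(\<Sum>i<?n. b $ e i) < (\<Sum>i<?n. a $ e i)"
        using ge that by (intro sum_strict_mono_ex1) auto
      then show False using total by simp
    qed
    then have "a = b" using ecase by (metis vec_eq_iff)
    then show ?thesis using refl by simp
  next
    case True
    define l where "l = (LEAST k. k < ?n \<and> a $ e k < b $ e k)"
    have l: "l < ?n" "a $ e l < b $ e l"
      using LeastI_ex[OF True] by (simp_all add: l_def)
    have before: "b $ e i \<le> a $ e i" if "i < l" for i
      using not_less_Least[of i "\<lambda>k. k < ?n \<and> a $ e k < b $ e k"] that l(1)
      by (fastforce simp: l_def)
    \<comment> \<open>Without an earlier surplus, the partial sum of \<open>a\<close> up to and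
      including \<open>l\<close> would fall below that of \<open>b\<close>; hence
      \<open>Suc l\<close>.\<close>
    have "\<exists>j<l. b $ e j < a $ e j"
    proof (rule ccontr)
      assume "\<not> ?thesis"
      then have "a $ e i \<le> b $ e i" if "i < l" for i
        using that by force
      then have "(\<Sum>i<l. a $ e i) \<le> (\<Sum>i<l. b $ e i)"
        by (intro sum_mono) simp
      then show False
        using dom[of "Suc l"] l by simp
    qed
    then obtain j where j: "j < l" "b $ e j < a $ e j" by blast
    \<comment> \<open>The largest amount that overshoots neither target; it settles
      \<open>e j\<close> or \<open>e l\<close>.\<close>
    define d where "d = min (a $ e j - b $ e j) (b $ e l - a $ e l)"
    have d: "0 < d" "d \<le> a $ e j - b $ e j" "d \<le> b $ e l - a $ e l"
      using l j by (auto simp: d_def)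
    define a' where "a' = transfer (e j) (e l) d a"
    have jl: "e j \<noteq> e l" "e l \<noteq> e j" using einj[of j l] j l by auto
    have a': "a' $ e i = (if i = j then a $ e j - d else if i = l then a $ e l + d else a $ e i)"
      if "i < ?n" for i
      using einj[OF that, of j] einj[OF that, of l] j l by (simp add: a'_def transfer_def)
    have R1: "R a a'"
      unfolding a'_def
    proof (rule step)
      \<comment> \<open>The donor stays above \<open>b $ e j\<close> and the receiver below
        \<open>b $ e l\<close>, so the order of \<open>b\<close> keeps the two from
        crossing.\<close>
      have "b $ e l \<le> b $ e j" using anti[of j l] j l by simp
      then show "a $ e l + d \<le> a $ e j - d" using d by linarith
    qed (use jl d in auto)
    have sums: "(\<Sum>i<m. a' $ e i) = (\<Sum>i<m. a $ e i) - (if j < m then d else 0) + (if l < m then d else 0)"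
      if "m \<le> ?n" for m
    proof -
      have "(\<Sum>i<m. a' $ e i) = (\<Sum>i<m. a $ e i + ((if i = j then - d else 0) + (if i = l then d else 0)))"
        using that j by (intro sum.cong) (auto simp: a')
      also have "\<dots> = (\<Sum>i<m. a $ e i) + ((if j < m then - d else 0) + (if l < m then d else 0))"
        by (simp add: sum.distrib sum.delta)
      finally show ?thesis by auto
    qed
    have "R a' b"
    proof (rule less.hyps)
      have sub: "{k. a' $ k \<noteq> b $ k} \<subseteq> {k. a $ k \<noteq> b $ k}"
      proof safe
        fix k assume k: "a' $ k \<noteq> b $ k" "a $ k = b $ k"
        obtain i where "i < ?n" "e i = k" using ecase by blast
        then show False using k a'[of i] j l by (auto split: if_splits)
      qed
      have "a' $ e j = b $ e j \<or> a' $ e l = b $ e l"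
        using a'[of j] a'[of l] j l by (auto simp: d_def min_def split: if_splits)
      then have "{k. a' $ k \<noteq> b $ k} \<noteq> {k. a $ k \<noteq> b $ k}"
        using j l by force
      with sub show "card {k. a' $ k \<noteq> b $ k} < card {k. a $ k \<noteq> b $ k}"
        by (intro psubset_card_mono) auto
      show "(\<Sum>i<?n. b $ e i) = (\<Sum>i<?n. a' $ e i)"
        using sums[of ?n] total j l by simp
      show "(\<Sum>i<m. b $ e i) \<le> (\<Sum>i<m. a' $ e i)" if m: "m \<le> ?n" for m
      proof (cases "j < m \<and> \<not> l < m")
        case True
        \<comment> \<open>Only a partial sum that contains \<open>j\<close> but not \<open>l\<close>
          loses \<open>d\<close>. All its terms precede the first deficit, so the surplus at
          \<open>j\<close> covers the loss.\<close>
        have "a $ e j - b $ e j \<le> (\<Sum>i<m. a $ e i - b $ e i)"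
          using True before by (intro member_le_sum) auto
        then show ?thesis
          using sums[OF m] True d by (simp add: sum_subtractf)
      next
        case False
        then show ?thesis using sums[OF m] dom[OF m] j by auto
      qed
    qed
    then show ?thesis using R1 trans by blast
  qed
qed

text \<open>Stated as an induction rule for a transitive relation, so that the weak and the strict
  inequality can both be read off the same chain. Reflexivity is the case of the identity
  permutation.\<close>

theorem majorizes_transfer_induct:
  fixes a b :: "real^'n"
  assumes maj: "majorizes a b"
    and perm: "\<And>a p. bij p \<Longrightarrow> R a (\<chi> i. a $ p i)"
    and step: "\<And>a i j d. i \<noteq> j \<Longrightarrow> 0 < d \<Longrightarrow> a $ j + d \<le> a $ i - d \<Longrightarrow> R a (transfer i j d a)"
    and trans: "\<And>a b c. R a b \<Longrightarrow> R b c \<Longrightarrow> R a c"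
  shows "R a b"
proof -
  let ?n = "CARD('n)"
  obtain e where e: "bij_betw e {..<?n} UNIV"
    and ea: "\<forall>j\<le>?n. sum_list (take j (decreasing_rearrangement a)) = (\<Sum>i<j. a $ e i)"
    and "\<forall>j<?n. \<forall>i\<le>j. a $ e j \<le> a $ e i"
    by (rule decreasing_rearrangement_enum[of a])
  obtain f where f: "bij_betw f {..<?n} UNIV"
    and fb: "\<forall>j\<le>?n. sum_list (take j (decreasing_rearrangement b)) = (\<Sum>i<j. b $ f i)"
    and anti: "\<forall>j<?n. \<forall>i\<le>j. b $ f j \<le> b $ f i"
    by (rule decreasing_rearrangement_enum[of b])
  \<comment> \<open>Matches ranks: the position of the m-th largest entry of \<open>b\<close> is
    sent to that of \<open>a\<close>, so the permuted \<open>a\<close> is sorted along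
    \<open>f\<close>.\<close>
  define p where "p = e \<circ> inv_into {..<?n} f"
  have p: "bij p"
    using bij_betw_trans[OF bij_betw_inv_into[OF f] e] by (simp add: p_def)
  have pf: "p (f i) = e i" if "i < ?n" for i
    using f that by (simp add: p_def bij_betw_def)
  define a' where "a' = (\<chi> i. a $ p i)"
  have a': "(\<Sum>i<m. a' $ f i) = sum_list (take m (decreasing_rearrangement a))" if "m \<le> ?n" for m
    using that by (auto simp: ea a'_def pf intro!: sum.cong)
  have dom: "(\<Sum>i<m. b $ f i) \<le> (\<Sum>i<m. a' $ f i)" if "m \<le> ?n" for m
    using maj that a'[OF that] fb[rule_format, OF that] by (cases "m = 0") (auto simp: majorizes_def dest!: bspec[of _ _ m])
  have "length (decreasing_rearrangement c) = ?n" for c :: "real^'n"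
    by (simp add: decreasing_rearrangement_def flip: size_mset)
  then have total: "(\<Sum>i<?n. b $ f i) = (\<Sum>i<?n. a' $ f i)"
    using maj a'[of ?n] fb[rule_format, of ?n] by (simp add: majorizes_def sum_decreasing_rearrangement)
  have "R a' b"
    by (rule transfer_chain_ordered[where R = R, OF f])
      (use anti perm[OF bij_id] step dom total in \<open>auto intro: trans\<close>)
  then show ?thesis
    using trans perm[OF p, of a] by (simp add: a'_def)
qed

section \<open>Isometries and points of density\<close>

lemma nn_integral_lborel_shift:
  fixes f :: "'a::euclidean_space \<Rightarrow> ennreal"
  assumes "f \<in> borel_measurable borel"
  shows "(\<integral>\<^sup>+x. f (x + c) \<partial>lborel) = (\<integral>\<^sup>+x. f x \<partial>lborel)"
  using nn_integral_distr[of "(+) c" lborel borel f] assms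
  by (simp add: lborel_distr_plus add.commute)

text \<open>
  This is the uniqueness argument for Haar measure; the library's change of variables for linear
  maps on \<open>real^'n\<close> needs a well-ordered index type.
\<close>

lemma lborel_distr_orthogonal:
  fixes T :: "'a::euclidean_space \<Rightarrow> 'a"
  assumes T: "orthogonal_transformation T"
  shows "distr lborel borel T = lborel"
proof (rule measure_eqI)
  fix A assume "A \<in> sets (distr lborel borel T)"
  then have A: "A \<in> sets borel" by simp
  have lin: "linear T" using T orthogonal_transformation_linear by blast
  have Tb [measurable]: "T \<in> borel_measurable borel"
    using linear_continuous_on[OF lin[unfolded linear_conv_bounded_linear]]
    by (rule borel_measurable_continuous_onI)
  have normT: "norm (T x) = norm x" for x
    using T by (simp add: orthogonal_transformation_norm)
  obtain T' where T': "linear T'" "\<And>x. T (T' x) = x"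
    using lin orthogonal_transformation_surj[OF T] linear_surjective_right_inverse
    by (metis comp_apply id_apply)
  note [measurable] = A
  define a :: "'a \<Rightarrow> ennreal" where "a = indicator A"
  \<comment> \<open>A weight of positive finite mass that \<open>T\<close> preserves. In the double
    integral of \<open>a (T x) * b y\<close>, shifting \<open>y\<close> by \<open>- T x\<close> and
    then \<open>x\<close> by \<open>T' y\<close> leads to \<open>a (y + T x) * b (- T x)\<close>,
    and \<open>b (- T x) = b x\<close> because \<open>T\<close> preserves norms.\<close>
  define b :: "'a \<Rightarrow> ennreal" where "b = indicator (ball 0 1)"
  have [measurable]: "a \<in> borel_measurable borel" "b \<in> borel_measurable borel"
    using A borel_open[OF open_ball[of "0::'a" 1]]
    by (auto simp: a_def b_def intro!: borel_measurable_indicator)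
  let ?v = "\<integral>\<^sup>+y. b y \<partial>lborel"
  have v: "?v = emeasure lborel (ball (0::'a) 1)"
    by (simp add: b_def)
  have "0 < measure lborel (ball (0::'a) 1)" by simp
  then have v0: "?v \<noteq> 0" "?v \<noteq> \<infinity>"
    unfolding v using emeasure_bounded_finite[of "ball (0::'a) 1"]
    by (auto simp: measure_def)
  have "?v * (\<integral>\<^sup>+x. a (T x) \<partial>lborel) = (\<integral>\<^sup>+x. \<integral>\<^sup>+y. a (T x) * b y \<partial>lborel \<partial>lborel)"
    by (simp add: nn_integral_cmult nn_integral_multc mult.commute)
  also have "\<dots> = (\<integral>\<^sup>+x. \<integral>\<^sup>+y. a (T x) * b (y + - T x) \<partial>lborel \<partial>lborel)"
    by (intro nn_integral_cong nn_integral_lborel_shift[symmetric]) measurable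
  also have "\<dots> = (\<integral>\<^sup>+y. \<integral>\<^sup>+x. a (T x) * b (y + - T x) \<partial>lborel \<partial>lborel)"
    by (intro lborel_pair.Fubini') measurable
  also have "\<dots> = (\<integral>\<^sup>+y. \<integral>\<^sup>+x. a (T (x + T' y)) * b (y + - T (x + T' y)) \<partial>lborel \<partial>lborel)"
    by (intro nn_integral_cong nn_integral_lborel_shift[symmetric]) measurable
  also have "\<dots> = (\<integral>\<^sup>+y. \<integral>\<^sup>+x. a (y + T x) * b x \<partial>lborel \<partial>lborel)"
    by (simp add: linear_add[OF lin] T' b_def indicator_def normT add.commute)
  also have "\<dots> = (\<integral>\<^sup>+x. \<integral>\<^sup>+y. a (y + T x) * b x \<partial>lborel \<partial>lborel)"
    by (intro lborel_pair.Fubini') measurable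
  also have "\<dots> = ?v * (\<integral>\<^sup>+y. a y \<partial>lborel)"
    by (simp add: nn_integral_multc nn_integral_lborel_shift nn_integral_cmult mult.commute)
  finally have "(\<integral>\<^sup>+x. a (T x) \<partial>lborel) = (\<integral>\<^sup>+y. a y \<partial>lborel)"
    using v0 by (simp add: ennreal_mult_cancel_left)
  moreover have "(\<integral>\<^sup>+x. a (T x) \<partial>lborel) = emeasure (distr lborel borel T) A"
    by (subst nn_integral_distr[of T lborel borel, symmetric]) (auto simp: a_def)
  ultimately show "emeasure (distr lborel borel T) A = emeasure lborel A"
    by (simp add: a_def)
qed simp

lemma lebesgue_distr_orthogonal:
  fixes T :: "'a::euclidean_space \<Rightarrow> 'a"
  assumes T: "orthogonal_transformation T"
  shows "T \<in> lebesgue \<rightarrow>\<^sub>M lebesgue" "distr lebesgue lebesgue T = lebesgue"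
proof -
  have "bounded_linear T"
    using T orthogonal_transformation_linear linear_conv_bounded_linear by blast
  then have "T \<in> borel_measurable borel"
    using linear_continuous_on by (intro borel_measurable_continuous_onI) blast
  then have Tb: "T \<in> lebesgue \<rightarrow>\<^sub>M lborel"
    by (auto intro: measurable_completion)
  have d: "distr lebesgue lborel T = lborel"
    using distr_completion[of T lborel lborel] lborel_distr_orthogonal[OF T] \<open>T \<in> borel_measurable borel\<close>
    by (simp cong: distr_cong)
  show "T \<in> lebesgue \<rightarrow>\<^sub>M lebesgue"
    using completion.measurable_completion2[OF Tb] d by simp
  show "distr lebesgue lebesgue T = lebesgue"
    using completion.completion_distr_eq[OF Tb] d by simp
qed

lemma integral_lebesgue_orthogonal:
  fixes T :: "'a::euclidean_space \<Rightarrow> 'a" and f :: "'a \<Rightarrow> real"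
  assumes T: "orthogonal_transformation T" and f: "f \<in> borel_measurable lebesgue"
  shows "(\<integral>x. f (T x) \<partial>lebesgue) = (\<integral>x. f x \<partial>lebesgue)"
  using integral_distr[OF lebesgue_distr_orthogonal(1)[OF T] f]
  by (simp add: lebesgue_distr_orthogonal(2)[OF T])


text \<open>Inside an open \<open>U\<close> exceeding a measurable hull \<open>E'\<close> of
  \<open>E\<close> by less than \<open>e\<close>, Vitali's theorem covers almost all of
  \<open>E\<close> by disjoint balls of which \<open>A\<close> fills at most half. Hence twice the
  measure of \<open>E'\<close> is at most that of \<open>U\<close>, thus at most the measure of
  \<open>E'\<close> plus \<open>e\<close>. Boundedness makes the measure of \<open>E'\<close>
  finite, so that it cancels.\<close>

lemma negligible_if_sparse_bounded:
  fixes A :: "'a::euclidean_space set"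
  assumes A: "A \<in> sets lebesgue" and EA: "E \<subseteq> A" and "bounded E"
    and sparse: "\<And>z d. z \<in> E \<Longrightarrow> 0 < d \<Longrightarrow>
      \<exists>r. 0 < r \<and> r < d \<and> 2 * emeasure lebesgue (A \<inter> ball z r) \<le> emeasure lebesgue (ball z r)"
  shows "negligible E"
proof -
  \<comment> \<open>\<open>E\<close> is not assumed measurable, so its outer measure is realized by
    a hull.\<close>
  obtain E' where E': "E' \<in> sets lebesgue" "E \<subseteq> E'" "outer_measure_of lebesgue E = emeasure lebesgue E'"
    using outer_measure_of_attain[of E lebesgue] by auto
  obtain R where R: "E \<subseteq> ball 0 R"
    using \<open>bounded E\<close> bounded_subset_ballD by blast
  have "emeasure lebesgue E' \<le> emeasure lebesgue (ball (0::'a) R)"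
    using outer_measure_of_mono[OF R, of lebesgue] E'(3) by simp
  also have "\<dots> < \<infinity>"
    using emeasure_bounded_finite[of "ball (0::'a) R"] by simp
  finally have fin: "emeasure lebesgue E' < \<infinity>" .
  have le: "emeasure lebesgue E' \<le> ennreal e" if "0 < e" for e
  proof -
    obtain U where U: "open U" "E' \<subseteq> U" "emeasure lebesgue (U - E') < ennreal e"
      by (rule sets_lebesgue_outer_open[OF E'(1) \<open>0 < e\<close>])
    define K where "K = {(z, r). z \<in> E \<and> ball z r \<subseteq> U \<and>
      2 * emeasure lebesgue (A \<inter> ball z r) \<le> emeasure lebesgue (ball z r)}"
    have vit: "\<exists>i. i \<in> K \<and> x \<in> ball (fst i) (snd i) \<and> snd i < d" if x: "x \<in> E" "0 < d" for x d
    proof -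
      obtain d' where d': "0 < d'" "ball x d' \<subseteq> U"
        using U x E'(2) by (meson openE subsetD)
      obtain r where r: "0 < r" "r < min d d'"
          "2 * emeasure lebesgue (A \<inter> ball x r) \<le> emeasure lebesgue (ball x r)"
        using sparse[OF x(1), of "min d d'"] d' x by auto
      moreover have "ball x r \<subseteq> U"
        using d' r by (meson min.strict_boundedE order.trans less_imp_le subset_ball)
      ultimately have "(x, r) \<in> K" "x \<in> ball x r"
        using x by (auto simp: K_def)
      then show ?thesis using r by (intro exI[of _ "(x, r)"]) auto
    qed
    obtain C where C: "countable C" "C \<subseteq> K"
        "pairwise (\<lambda>i j. disjnt (ball (fst i) (snd i)) (ball (fst j) (snd j))) C"
        "negligible (E - (\<Union>i\<in>C. ball (fst i) (snd i)))"
      by (rule Vitali_covering_theorem_balls[of E K fst snd, OF vit])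
    let ?B = "\<lambda>i. ball (fst i) (snd i) :: 'a set"
    have disj: "disjoint_family_on ?B C" "disjoint_family_on (\<lambda>i. A \<inter> ?B i) C"
      using C(3) unfolding disjoint_family_on_def pairwise_def disjnt_def by blast+
    let ?N = "E - (\<Union>i\<in>C. ?B i)" and ?W = "\<Union>i\<in>C. A \<inter> ?B i"
    have N: "?N \<in> null_sets lebesgue"
      using C(4) by (simp add: negligible_iff_null_sets)
    have W: "?W \<in> sets lebesgue"
      using C(1) A by (intro sets.countable_UN'') auto
    have "E \<subseteq> ?W \<union> ?N"
      using EA by auto
    then have "outer_measure_of lebesgue E \<le> emeasure lebesgue (?W \<union> ?N)"
      using outer_measure_of_mono[of E "?W \<union> ?N" lebesgue] sets.Un[OF W null_setsD2[OF N]]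
      by (simp only: outer_measure_of_eq)
    then have "emeasure lebesgue E' \<le> emeasure lebesgue ?W"
      using E'(3) emeasure_Un_null_set[OF W N] by simp
    then have "2 * emeasure lebesgue E' \<le> 2 * emeasure lebesgue ?W"
      by (rule mult_left_mono) simp
    also have "\<dots> = 2 * (\<integral>\<^sup>+i. emeasure lebesgue (A \<inter> ?B i) \<partial>count_space C)"
      using C(1) A disj by (subst emeasure_UN_countable) auto
    also have "\<dots> = (\<integral>\<^sup>+i. 2 * emeasure lebesgue (A \<inter> ?B i) \<partial>count_space C)"
      by (simp add: nn_integral_cmult)
    also have "\<dots> \<le> (\<integral>\<^sup>+i. emeasure lebesgue (?B i) \<partial>count_space C)"
      using C(2) by (intro nn_integral_mono) (auto simp: K_def)
    also have "\<dots> = emeasure lebesgue (\<Union>i\<in>C. ?B i)"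
      using C(1) disj by (subst emeasure_UN_countable) auto
    also have "\<dots> \<le> emeasure lebesgue U"
    proof (rule emeasure_mono)
      show "(\<Union>i\<in>C. ?B i) \<subseteq> U" using C(2) by (fastforce simp: K_def)
    qed (use U(1) in auto)
    also have "U = E' \<union> (U - E')"
      using U(2) by auto
    also have "emeasure lebesgue \<dots> \<le> emeasure lebesgue E' + emeasure lebesgue (U - E')"
      using E'(1) U(1) by (intro emeasure_subadditive) auto
    also have "\<dots> \<le> emeasure lebesgue E' + ennreal e"
      using U(3) by (intro add_left_mono) simp
    finally show ?thesis
      using fin by (auto simp: mult_2 ennreal_add_left_cancel_le)
  qed
  have "emeasure lebesgue E' \<le> 0"
    by (rule ennreal_le_epsilon) (use le in auto)
  then have "negligible E'"
    using E'(1) by (auto simp: negligible_iff_null_sets null_sets_def)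
  then show ?thesis
    using E'(2) negligible_subset by blast
qed

text \<open>
  A canonical representative of \<open>A\<close> up to null sets: it commutes exactly with isometries,
  whatever null set \<open>A\<close> is changed on. The threshold 1/2 replaces density 1 because
  it already separates \<open>A\<close> from its complement.
\<close>

definition density_set :: "'a::euclidean_space set \<Rightarrow> 'a set" where
  "density_set A = {z. \<forall>\<^sub>F r in at_right 0.
     emeasure lebesgue (ball z r) < 2 * emeasure lebesgue (A \<inter> ball z r)}"

lemma negligible_if_sparse:
  fixes A :: "'a::euclidean_space set"
  assumes A: "A \<in> sets lebesgue"
    and sparse: "\<And>z. z \<in> E \<Longrightarrow>
      \<exists>\<^sub>F r in at_right 0. 2 * emeasure lebesgue (A \<inter> ball z r) \<le> emeasure lebesgue (ball z r)"
    and "E \<subseteq> A"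
  shows "negligible E"
proof -
  have "negligible (E \<inter> ball 0 (real n))" for n
  proof (rule negligible_if_sparse_bounded[OF A])
    fix z d assume "z \<in> E \<inter> ball 0 (real n)" "(0::real) < d"
    then have "\<exists>\<^sub>F r in at_right 0. 2 * emeasure lebesgue (A \<inter> ball z r) \<le> emeasure lebesgue (ball z r)"
      using sparse by blast
    moreover have "\<forall>\<^sub>F r in at_right 0. 0 < r \<and> r < d"
      using eventually_at_right_real[OF \<open>0 < d\<close>] by (rule eventually_mono) simp
    ultimately have "\<exists>\<^sub>F r in at_right 0. 2 * emeasure lebesgue (A \<inter> ball z r) \<le> emeasure lebesgue (ball z r)
        \<and> (0 < r \<and> r < d)"
      by (rule frequently_eventually_frequently)
    then show "\<exists>r>0. r < d \<and> 2 * emeasure lebesgue (A \<inter> ball z r) \<le> emeasure lebesgue (ball z r)"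
      using frequently_ex by fastforce
  qed (use \<open>E \<subseteq> A\<close> in auto)
  then have "negligible (\<Union>n. E \<inter> ball 0 (real n))"
    by (intro negligible_Union_nat)
  also have "(\<Union>n. E \<inter> ball 0 (real n)) = E"
    using reals_Archimedean2 by auto
  finally show ?thesis .
qed

text \<open>At a point of \<open>A\<close> outside the density set, \<open>A\<close> fills at most
  half of arbitrarily small balls; at a point of the density set outside \<open>A\<close>, the
  complement does so for all small balls. The same sparseness criterion thus handles both
  differences, applied to \<open>A\<close> and to \<open>- A\<close>.\<close>

lemma AE_density_set:
  fixes A :: "'a::euclidean_space set"
  assumes A: "A \<in> sets lebesgue"
  shows "AE z in lebesgue. z \<in> density_set A \<longleftrightarrow> z \<in> A"
proof -
  have "negligible (A - density_set A)"
    by (rule negligible_if_sparse[OF A]) (auto simp: density_set_def frequently_def not_le)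
  moreover have "negligible (density_set A - A)"
  proof (rule negligible_if_sparse)
    show A': "- A \<in> sets lebesgue"
      using A by (simp add: Compl_in_sets_lebesgue)
    fix z assume "z \<in> density_set A - A"
    then have "\<forall>\<^sub>F r in at_right 0. emeasure lebesgue (ball z r) < 2 * emeasure lebesgue (A \<inter> ball z r)"
      by (simp add: density_set_def)
    then have "\<forall>\<^sub>F r in at_right 0. 2 * emeasure lebesgue (- A \<inter> ball z r) \<le> emeasure lebesgue (ball z r)"
    proof (rule eventually_mono)
      fix r
      let ?a = "emeasure lebesgue (A \<inter> ball z r)" and ?b = "emeasure lebesgue (- A \<inter> ball z r)"
      assume less: "emeasure lebesgue (ball z r) < 2 * ?a"
      have "ball z r = (A \<inter> ball z r) \<union> (- A \<inter> ball z r)" by auto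
      moreover have "?a + ?b = emeasure lebesgue ((A \<inter> ball z r) \<union> (- A \<inter> ball z r))"
        using A A' by (intro plus_emeasure) auto
      ultimately have eq: "emeasure lebesgue (ball z r) = ?a + ?b" by simp
      have "?a + ?b < ?a + ?a" using less eq by (simp add: mult_2)
      then have "?b \<le> ?a"
        by (meson add_left_mono leD linear)
      then show "2 * ?b \<le> emeasure lebesgue (ball z r)"
        unfolding eq by (simp add: mult_2 add_right_mono)
    qed
    then show "\<exists>\<^sub>F r in at_right 0. 2 * emeasure lebesgue (- A \<inter> ball z r) \<le> emeasure lebesgue (ball z r)"
      by (simp add: eventually_frequently)
  qed auto
  ultimately have "A - density_set A \<in> null_sets lebesgue" "density_set A - A \<in> null_sets lebesgue"
    by (simp_all add: negligible_iff_null_sets)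
  then show ?thesis
    by (auto dest!: AE_not_in)
qed

lemma density_set_orthogonal:
  fixes T :: "'a::euclidean_space \<Rightarrow> 'a"
  assumes T: "orthogonal_transformation T" and A: "A \<in> sets lebesgue"
  shows "z \<in> density_set (T -` A) \<longleftrightarrow> T z \<in> density_set A"
proof -
  have "emeasure lebesgue (T -` A \<inter> ball z r) = emeasure lebesgue (A \<inter> ball (T z) r)" for r
  proof -
    have "dist (T z) (T w) = dist z w" for w
      using T by (simp add: dist_norm orthogonal_transformation_linear linear_diff[symmetric] orthogonal_transformation_norm)
    then have "T -` A \<inter> ball z r = T -` (A \<inter> ball (T z) r)"
      by auto
    then show ?thesis
      using emeasure_distr[OF lebesgue_distr_orthogonal(1)[OF T], of "A \<inter> ball (T z) r"] A
      by (simp add: lebesgue_distr_orthogonal(2)[OF T] sets.Int del: emeasure_completion)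
  qed
  moreover have "emeasure lebesgue (ball z r) = emeasure lebesgue (ball (T z) r)" for r
    by (cases "r \<ge> 0") (simp_all add: emeasure_ball ball_empty)
  ultimately show ?thesis
    by (simp add: density_set_def)
qed

text \<open>Membership of \<open>z\<close> depends only on the set near \<open>z\<close> and up to
  null sets. This turns an inclusion known almost everywhere on a small ball into a statement about
  the point \<open>z\<close> itself.\<close>

lemma density_set_local_mono:
  fixes A B :: "'a::euclidean_space set"
  assumes "z \<in> density_set A" "0 < d" and B: "B \<in> sets lebesgue"
    and AB: "AE w in lebesgue. w \<in> ball z d \<longrightarrow> w \<in> A \<longrightarrow> w \<in> B"
  shows "z \<in> density_set B"
proof -
  have "\<forall>\<^sub>F r in at_right 0. 0 < r \<and> r < d"
    using eventually_at_right_real[OF \<open>0 < d\<close>] by (rule eventually_mono) simp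
  moreover have "\<forall>\<^sub>F r in at_right 0. emeasure lebesgue (ball z r) < 2 * emeasure lebesgue (A \<inter> ball z r)"
    using assms(1) by (simp add: density_set_def)
  ultimately have "\<forall>\<^sub>F r in at_right 0. emeasure lebesgue (ball z r) < 2 * emeasure lebesgue (B \<inter> ball z r)"
  proof eventually_elim
    case (elim r)
    have "emeasure lebesgue (A \<inter> ball z r) \<le> emeasure lebesgue (B \<inter> ball z r)"
      using AB B elim(1) by (intro emeasure_mono_AE) (auto elim!: eventually_mono)
    then show ?case
      using elim(2) by (meson less_le_trans mult_left_mono zero_le)
  qed
  then show ?thesis
    by (simp add: density_set_def)
qed

section \<open>Hyperbolic and trigonometric inequalities\<close>

lemma sinh_less_times_cosh:
  fixes x :: real
  assumes "0 < x"
  shows "sinh x < x * cosh x"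
proof -
  have "0 * cosh 0 - sinh 0 < x * cosh x - sinh (x::real)"
  proof (rule DERIV_pos_imp_increasing_open[OF assms])
    show "\<exists>y. ((\<lambda>x. x * cosh x - sinh x) has_real_derivative y) (at z) \<and> 0 < y" if "0 < z" for z :: real
      using that by (intro exI[of _ "z * sinh z"]) (auto intro!: derivative_eq_intros)
  qed (auto intro!: continuous_intros)
  then show ?thesis by simp
qed

text \<open>\<open>sinh x / x\<close> is twice the derivative of \<open>cosh (sqrt s)\<close> at
  \<open>s = x\<^sup>2\<close>, so its growth is the strict convexity used next. The previous lemma
  gives the sign of the numerator of its derivative.\<close>

lemma sinh_divide_less:
  fixes x y :: real
  assumes "0 < x" "x < y"
  shows "sinh x / x < sinh y / y"
proof (rule DERIV_pos_imp_increasing_open[OF assms(2)])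
  show "\<exists>d. ((\<lambda>x. sinh x / x) has_real_derivative d) (at z) \<and> 0 < d" if "x < z" for z
    using that assms sinh_less_times_cosh[of z]
    by (intro exI[of _ "(cosh z * z - sinh z * 1) / (z * z)"])
       (auto intro!: derivative_eq_intros divide_pos_pos simp: mult.commute)
qed (use assms in \<open>auto intro!: continuous_intros\<close>)

text \<open>This is strict convexity of \<open>\<lambda>s. cosh (sqrt s)\<close>.\<close>

lemma cosh_sum_less_ordered:
  fixes u v u' v' :: real
  assumes "0 \<le> v'" "v' < v" "v \<le> u" "u < u'" and eq: "u\<^sup>2 + v\<^sup>2 = u'\<^sup>2 + v'\<^sup>2"
  shows "cosh u + cosh v < cosh u' + cosh v'"
proof -
  \<comment> \<open>Cauchy's mean value theorem against \<open>x\<^sup>2\<close> stands for the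
    ordinary one in the variable \<open>s = x\<^sup>2\<close>; it avoids differentiating
    \<open>sqrt\<close> at the endpoint 0.\<close>
  have mvt: "\<exists>c>a. c < b \<and> cosh b - cosh a = (b\<^sup>2 - a\<^sup>2) * (sinh c / c / 2)"
    if "0 \<le> a" "a < b" for a b :: real
  proof -
    have "\<exists>c>a. c < b \<and> (cosh b - cosh a) * (2 * c) = (b\<^sup>2 - a\<^sup>2) * sinh c"
    proof (rule GMVT'[of a b cosh "\<lambda>x. x\<^sup>2" "\<lambda>c. 2 * c" sinh])
    qed (use that in \<open>auto intro!: derivative_eq_intros isCont_cosh\<close>)
    then obtain c where "a < c" "c < b" "(cosh b - cosh a) * (2 * c) = (b\<^sup>2 - a\<^sup>2) * sinh c"
      by blast
    then show ?thesis
      using that by (intro exI[of _ c]) (auto simp: field_simps)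
  qed
  obtain c where c: "u < c" "c < u'" "cosh u' - cosh u = (u'\<^sup>2 - u\<^sup>2) * (sinh c / c / 2)"
    using mvt[of u u'] assms by auto
  obtain d where d: "v' < d" "d < v" "cosh v - cosh v' = (v\<^sup>2 - v'\<^sup>2) * (sinh d / d / 2)"
    using mvt[of v' v] assms by auto
  have "(v\<^sup>2 - v'\<^sup>2) * (sinh d / d / 2) < (v\<^sup>2 - v'\<^sup>2) * (sinh c / c / 2)"
    using assms c d sinh_divide_less[of d c] power_strict_mono[of v' v 2]
    by (intro mult_strict_left_mono divide_strict_right_mono) auto
  moreover have "v\<^sup>2 - v'\<^sup>2 = u'\<^sup>2 - u\<^sup>2" using eq by simp
  ultimately show ?thesis using c d by simp
qed

text \<open>All expressions are unchanged by signs and by exchanging the two arguments, so both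
  pairs may be replaced by their sorted absolute values. With the sum of squares fixed, a larger gap
  between the squares then means a more spread pair.\<close>

lemma cosh_sum_less:
  fixes u v u' v' :: real
  assumes eq: "u\<^sup>2 + v\<^sup>2 = u'\<^sup>2 + v'\<^sup>2" and less: "(u\<^sup>2 - v\<^sup>2)\<^sup>2 < (u'\<^sup>2 - v'\<^sup>2)\<^sup>2"
  shows "cosh u + cosh v < cosh u' + cosh v'"
proof -
  have *: "cosh a + cosh b < cosh a' + cosh b'"
    if "0 \<le> b" "b \<le> a" "0 \<le> b'" "b' \<le> a'" and e: "a\<^sup>2 + b\<^sup>2 = a'\<^sup>2 + b'\<^sup>2"
      and l: "(a\<^sup>2 - b\<^sup>2)\<^sup>2 < (a'\<^sup>2 - b'\<^sup>2)\<^sup>2" for a b a' b' :: real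
  proof -
    have "0 \<le> a\<^sup>2 - b\<^sup>2" "0 \<le> a'\<^sup>2 - b'\<^sup>2"
      using that by (auto intro!: power_mono)
    then have "a\<^sup>2 - b\<^sup>2 < a'\<^sup>2 - b'\<^sup>2"
      using l power2_less_imp_less by blast
    then have "a\<^sup>2 < a'\<^sup>2" "b'\<^sup>2 < b\<^sup>2" using e by linarith+
    then have "a < a'" "b' < b"
      using that power2_less_imp_less[of a a'] power2_less_imp_less[of b' b] by auto
    then show ?thesis
      using cosh_sum_less_ordered[of b' b a a'] that by simp
  qed
  let ?M = "\<lambda>a b :: real. max \<bar>a\<bar> \<bar>b\<bar>" and ?m = "\<lambda>a b :: real. min \<bar>a\<bar> \<bar>b\<bar>"
  have c: "cosh (?M a b) + cosh (?m a b) = cosh a + cosh b" for a b :: real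
    by (auto simp: max_def min_def)
  have s: "(?M a b)\<^sup>2 + (?m a b)\<^sup>2 = a\<^sup>2 + b\<^sup>2" for a b
    by (auto simp: max_def min_def)
  have t: "((?M a b)\<^sup>2 - (?m a b)\<^sup>2)\<^sup>2 = (a\<^sup>2 - b\<^sup>2)\<^sup>2" for a b
    by (auto simp: max_def min_def power2_commute)
  show ?thesis
    using *[of "?m u v" "?M u v" "?m u' v'" "?M u' v'"] eq less unfolding c s t by auto
qed

lemma cosh_circle_less:
  fixes c s t :: real
  assumes "0 < c" and less: "(cos (2 * s))\<^sup>2 < (cos (2 * t))\<^sup>2"
  shows "cosh (c * cos s) + cosh (c * sin s) < cosh (c * cos t) + cosh (c * sin t)"
proof (rule cosh_sum_less)
  have "(c * cos x)\<^sup>2 + (c * sin x)\<^sup>2 = c\<^sup>2" for x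
    by (simp add: power_mult_distrib flip: distrib_left)
  then show "(c * cos s)\<^sup>2 + (c * sin s)\<^sup>2 = (c * cos t)\<^sup>2 + (c * sin t)\<^sup>2" by simp
  have "((c * cos x)\<^sup>2 - (c * sin x)\<^sup>2)\<^sup>2 = c^4 * (cos (2 * x))\<^sup>2" for x
    by (simp add: cos_double power_mult_distrib flip: right_diff_distrib)
  then show "((c * cos s)\<^sup>2 - (c * sin s)\<^sup>2)\<^sup>2 < ((c * cos t)\<^sup>2 - (c * sin t)\<^sup>2)\<^sup>2"
    using assms by simp
qed

text \<open>For the two pairs of angles compared in \<open>gauss_sum_sign\<close>, one sine factor
  is common and the other is positive. The two differences therefore have the same sign.\<close>

lemma cos_double_squared_diff:
  fixes a b :: real
  shows "(cos (2 * a))\<^sup>2 - (cos (2 * b))\<^sup>2 = sin (2 * (a + b)) * sin (2 * (b - a))"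
proof -
  have "sin (x + y) * sin (x - y) = (cos y)\<^sup>2 - (cos x)\<^sup>2" for x y :: real
  proof -
    have "sin (x + y) * sin (x - y) = (sin x)\<^sup>2 * (cos y)\<^sup>2 - (cos x)\<^sup>2 * (sin y)\<^sup>2"
      by (simp add: sin_add sin_diff power2_eq_square algebra_simps)
    then show ?thesis
      by (simp add: sin_squared_eq algebra_simps)
  qed
  from this[of "2 * b" "2 * a"] show ?thesis
    by (simp add: algebra_simps)
qed

text \<open>Evenness and the reflection give the period \<open>2 * \<mu>\<close>. Either it or
  \<open>pi / 2 - 2 * \<mu>\<close> is a positive period \<open>\<tau>\<close> of length at most
  \<open>pi / 4\<close>, so \<open>[0, \<tau>]\<close> lies in the range of monotonicity and
  \<open>f\<close> takes equal values at its ends.\<close>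

lemma periodic_reflection_const:
  fixes f :: "real \<Rightarrow> bool"
  assumes even: "\<And>t. f (- t) = f t" and per: "\<And>t. f (t + pi / 2) = f t"
    and mono: "\<And>s t. 0 \<le> s \<Longrightarrow> s \<le> t \<Longrightarrow> t \<le> pi / 4 \<Longrightarrow> f s \<Longrightarrow> f t"
    and refl: "\<And>t. f (2 * \<mu> - t) = f t" and \<mu>: "0 < \<mu>" "\<mu> < pi / 4"
  shows "f s = f t"
proof -
  have shift: "f (t + 2 * \<mu>) = f t" for t
    using refl[of "- t"] even[of t] by (simp add: add.commute)
  obtain \<tau> where \<tau>: "0 < \<tau>" "\<tau> \<le> pi / 4" "\<And>t. f (t + \<tau>) = f t"
  proof (cases "2 * \<mu> \<le> pi / 4")
    case True
    then show ?thesis using that[of "2 * \<mu>"] shift \<mu> by simp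
  next
    case False
    have "f (t + (pi / 2 - 2 * \<mu>)) = f t" for t
      using per[of "t - 2 * \<mu>"] shift[of "t - 2 * \<mu>"] by (simp add: algebra_simps)
    then show ?thesis using that[of "pi / 2 - 2 * \<mu>"] False \<mu> by simp
  qed
  have up: "f (t + real n * \<tau>) = f t" for t n
  proof (induction n)
    case (Suc n)
    then show ?case using \<tau>(3)[of "t + real n * \<tau>"] by (simp add: algebra_simps)
  qed simp
  have per\<tau>: "f (t + of_int m * \<tau>) = f t" for t m
    using up[of t "nat m"] up[of "t + of_int m * \<tau>" "nat (- m)"] by (cases "m \<ge> 0") auto
  have "f t \<longleftrightarrow> f 0" for t
  proof -
    define r where "r = t - of_int \<lfloor>t / \<tau>\<rfloor> * \<tau>"
    have r: "0 \<le> r" "r \<le> \<tau>"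
      using floor_divide_lower[OF \<tau>(1), of t] floor_divide_upper[OF \<tau>(1), of t]
      by (simp_all add: r_def algebra_simps)
    have "f t = f r"
      using per\<tau>[of r "\<lfloor>t / \<tau>\<rfloor>"] by (simp add: r_def)
    also have "f r = f 0"
      using mono[of 0 r] mono[of r \<tau>] \<tau>(3)[of 0] r \<tau> by auto
    finally show ?thesis .
  qed
  from this[of s] this[of t] show ?thesis by simp
qed

section \<open>Gaussian kernels in a coordinate plane\<close>

lemma sum_UNIV_pair:
  fixes f :: "'n::finite \<Rightarrow> 'a::comm_monoid_add"
  assumes "i \<noteq> j"
  shows "sum f UNIV = f i + (f j + sum f (UNIV - {i, j}))"
  using assms by (subst sum.subset_diff[of "{i, j}"]) (auto simp: algebra_simps)

lemma norm_squared_pair: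
  fixes z :: "real^'n"
  assumes "i \<noteq> j"
  shows "(norm z)\<^sup>2 = (z $ i)\<^sup>2 + ((z $ j)\<^sup>2 + (\<Sum>k\<in>UNIV - {i, j}. (z $ k)\<^sup>2))"
proof -
  have "(norm z)\<^sup>2 = (\<Sum>k\<in>UNIV. (z $ k)\<^sup>2)"
    by (simp add: norm_vec_def L2_set_def sum_nonneg)
  then show ?thesis by (simp add: sum_UNIV_pair[OF assms])
qed

text \<open>An arbitrary 2 by 2 matrix acting on one coordinate plane, so that rotations and
  reflections share one proof of orthogonality.\<close>

definition plane_map :: "'n \<Rightarrow> 'n \<Rightarrow> real \<Rightarrow> real \<Rightarrow> real \<Rightarrow> real \<Rightarrow> real^'n \<Rightarrow> real^'n" where
  "plane_map i j p q r s z =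
     (\<chi> k. if k = i then p * z $ i + q * z $ j else if k = j then r * z $ i + s * z $ j else z $ k)"

lemma plane_map_orthogonal:
  fixes i j :: "'n::finite"
  assumes "i \<noteq> j" and c: "p\<^sup>2 + r\<^sup>2 = 1" "q\<^sup>2 + s\<^sup>2 = 1" "p * q + r * s = 0"
  shows "orthogonal_transformation (plane_map i j p q r s)"
  unfolding orthogonal_transformation
proof (intro conjI allI)
  show "linear (plane_map i j p q r s)"
    by (rule linearI) (simp_all add: plane_map_def vec_eq_iff algebra_simps)
  fix v :: "real^'n"
  have "(p * a + q * b)\<^sup>2 + (r * a + s * b)\<^sup>2
      = (p\<^sup>2 + r\<^sup>2) * a\<^sup>2 + (q\<^sup>2 + s\<^sup>2) * b\<^sup>2 + 2 * (p * q + r * s) * (a * b)" for a b :: real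
    by (simp add: power2_eq_square algebra_simps)
  then have "(p * a + q * b)\<^sup>2 + (r * a + s * b)\<^sup>2 = a\<^sup>2 + b\<^sup>2" for a b :: real
    by (simp add: c)
  then have "(norm (plane_map i j p q r s v))\<^sup>2 = (norm v)\<^sup>2"
    using \<open>i \<noteq> j\<close> by (simp add: norm_squared_pair[OF \<open>i \<noteq> j\<close>] plane_map_def flip: add.assoc)
  then show "norm (plane_map i j p q r s v) = norm v" by simp
qed

text \<open>\<open>w\<close> supplies the coordinates outside the plane; a circle is traced by
  varying \<open>t\<close> alone.\<close>

definition polar :: "'n \<Rightarrow> 'n \<Rightarrow> real \<Rightarrow> real \<Rightarrow> real^'n \<Rightarrow> real^'n" where
  "polar i j r t w = (\<chi> k. if k = i then r * cos t else if k = j then r * sin t else w $ k)"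

definition rotation :: "'n \<Rightarrow> 'n \<Rightarrow> real \<Rightarrow> real^'n \<Rightarrow> real^'n" where
  "rotation i j t = plane_map i j (cos t) (- sin t) (sin t) (cos t)"

text \<open>The reflection in the line at angle \<open>t\<close> of the \<open>(i, j)\<close>-plane.\<close>

definition reflection :: "'n \<Rightarrow> 'n \<Rightarrow> real \<Rightarrow> real^'n \<Rightarrow> real^'n" where
  "reflection i j t = plane_map i j (cos (2 * t)) (sin (2 * t)) (sin (2 * t)) (- cos (2 * t))"

lemma rotation_orthogonal: "i \<noteq> j \<Longrightarrow> orthogonal_transformation (rotation i j t)"
  by (simp add: rotation_def plane_map_orthogonal)

lemma reflection_orthogonal: "i \<noteq> j \<Longrightarrow> orthogonal_transformation (reflection i j t)"
  by (simp add: reflection_def plane_map_orthogonal)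

lemma rotation_polar:
  assumes "i \<noteq> j"
  shows "rotation i j s (polar i j r t w) = polar i j r (t + s) w"
  using assms
  by (simp add: rotation_def plane_map_def polar_def vec_eq_iff cos_add sin_add algebra_simps)

lemma reflection_polar:
  assumes "i \<noteq> j"
  shows "reflection i j s (polar i j r t w) = polar i j r (2 * s - t) w"
  using assms
  by (simp add: reflection_def plane_map_def polar_def vec_eq_iff cos_diff sin_diff algebra_simps)

lemma polar_decomposition:
  fixes z :: "real^'n"
  assumes "i \<noteq> j"
  obtains r t where "0 \<le> r" "polar i j r t z = z"
proof -
  obtain r t where "Complex (z $ i) (z $ j) = rcis r t" "0 \<le> r"
    using rcis_cmod_Arg by (metis norm_ge_zero)
  then have "0 \<le> r" "polar i j r t z = z"
    by (auto simp: polar_def vec_eq_iff complex_eq_iff)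
  then show ?thesis using that by blast
qed

lemma reflection_involution:
  fixes z :: "real^'n"
  assumes "i \<noteq> j"
  shows "reflection i j s (reflection i j s z) = z"
proof -
  obtain r t where "polar i j r t z = z"
    using polar_decomposition[OF assms] by blast
  then show ?thesis
    using reflection_polar[OF assms, of s r t z] reflection_polar[OF assms, of s r "2 * s - t" z] by simp
qed

text \<open>On a circle, the squared gap between the two squared coordinates determines the position
  in the majorization order: the smaller the gap, the lower the vector of squares.\<close>

lemma polar_squared_diff:
  assumes "i \<noteq> j"
  shows "((polar i j r t w $ i)\<^sup>2 - (polar i j r t w $ j)\<^sup>2)\<^sup>2 = (r\<^sup>2 * cos (2 * t))\<^sup>2"
  using assms by (simp add: polar_def cos_double power_mult_distrib right_diff_distrib)

lemma polar_squared_sum: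
  assumes "i \<noteq> j"
  shows "(polar i j r t w $ i)\<^sup>2 + (polar i j r t w $ j)\<^sup>2 = r\<^sup>2"
  using assms by (simp add: polar_def power_mult_distrib flip: distrib_left)

section \<open>Gaussian kernels along a circle\<close>

definition gauss :: "real^'n \<Rightarrow> real" where
  "gauss z = exp (- (norm z)\<^sup>2 / 2)"

lemma gauss_pos: "0 < gauss z"
  by (simp add: gauss_def)

lemma continuous_gauss: "continuous_on UNIV gauss"
  unfolding gauss_def by (intro continuous_intros) simp

lemma gauss_measurable [measurable]: "gauss \<in> borel_measurable borel"
  using continuous_gauss by (rule borel_measurable_continuous_onI)

lemma gauss_orthogonal: "orthogonal_transformation T \<Longrightarrow> gauss (T z) = gauss z"
  by (simp add: gauss_def orthogonal_transformation_norm)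

text \<open>
  Averaging over quarter turns, under which the sets in question are invariant, makes the
  reflection exchanging the angles \<open>s\<close> and \<open>t\<close> exchange the kernels for \<open>s\<close> and \<open>t\<close>.
\<close>

definition gauss_sum :: "'n \<Rightarrow> 'n \<Rightarrow> real \<Rightarrow> real^'n \<Rightarrow> real \<Rightarrow> real^'n \<Rightarrow> real" where
  "gauss_sum i j \<rho> w t z = (\<Sum>m<4. gauss (z + polar i j \<rho> (t + real m * (pi / 2)) w))"

text \<open>Expanding the squared norm leaves \<open>r * \<rho> * cos (t - u)\<close> as the only
  dependence on the angles. Quarter turns of \<open>u\<close> take this cosine through the cosine
  and sine of \<open>t - s\<close> with both signs, and the four exponentials pair into hyperbolic
  cosines.\<close>

lemma gauss_sum_polar:
  fixes i j :: "'n::finite"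
  assumes "i \<noteq> j"
  shows "gauss_sum i j \<rho> w s (polar i j r t v) =
    exp (- (r\<^sup>2 + \<rho>\<^sup>2 + (\<Sum>k\<in>UNIV - {i, j}. (v $ k + w $ k)\<^sup>2)) / 2) *
    (2 * (cosh (r * \<rho> * cos (t - s)) + cosh (r * \<rho> * sin (t - s))))"
proof -
  let ?E = "r\<^sup>2 + \<rho>\<^sup>2 + (\<Sum>k\<in>UNIV - {i, j}. (v $ k + w $ k)\<^sup>2)"
  have *: "gauss (polar i j r t v + polar i j \<rho> u w) = exp (- ?E / 2) * exp (- (r * \<rho> * cos (t - u)))" for u
  proof -
    have "(r * a + \<rho> * b)\<^sup>2 + (r * c + \<rho> * d)\<^sup>2
      = r\<^sup>2 * (a\<^sup>2 + c\<^sup>2) + \<rho>\<^sup>2 * (b\<^sup>2 + d\<^sup>2) + 2 * (r * \<rho> * (a * b + c * d))" for a b c d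
      by (simp add: power2_eq_square algebra_simps)
    from this[of "cos t" "cos u" "sin t" "sin u"]
    have "(r * cos t + \<rho> * cos u)\<^sup>2 + (r * sin t + \<rho> * sin u)\<^sup>2
      = r\<^sup>2 + \<rho>\<^sup>2 + 2 * (r * \<rho> * cos (t - u))"
      by (simp add: cos_diff)
    moreover have "(norm (polar i j r t v + polar i j \<rho> u w))\<^sup>2
      = (r * cos t + \<rho> * cos u)\<^sup>2 + (r * sin t + \<rho> * sin u)\<^sup>2 + (\<Sum>k\<in>UNIV - {i, j}. (v $ k + w $ k)\<^sup>2)"
      using assms by (simp add: norm_squared_pair[OF assms] polar_def)
    ultimately have "(norm (polar i j r t v + polar i j \<rho> u w))\<^sup>2 = ?E + 2 * (r * \<rho> * cos (t - u))"
      by simp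
    then show ?thesis
      by (simp add: gauss_def exp_add[symmetric] field_simps)
  qed
  define f where "f m = cos (t - (s + real m * (pi / 2)))" for m
  have cos3: "cos (3 * pi / 2) = 0" "sin (3 * pi / 2) = - 1"
    using cos_3over2_pi sin_3over2_pi by simp_all
  have shift: "cos (x - pi / 2) = sin x" "cos (x - pi) = - cos x" "cos (x - 3 * pi / 2) = - sin x" for x :: real
    by (simp_all add: cos_diff cos3)
  have f: "f 0 = cos (t - s)" "f 1 = sin (t - s)" "f 2 = - cos (t - s)" "f 3 = - sin (t - s)"
    using shift[of "t - s"] by (simp_all add: f_def diff_diff_eq)
  have "gauss_sum i j \<rho> w s (polar i j r t v) = (\<Sum>m<4. exp (- ?E / 2) * exp (- (r * \<rho> * f m)))"
    by (simp only: gauss_sum_def * f_def)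
  also have "{..<4} = {0, 1, 2, 3::nat}" by auto
  also have "(\<Sum>m\<in>\<dots>. exp (- ?E / 2) * exp (- (r * \<rho> * f m))) =
    exp (- ?E / 2) * (exp (- (r * \<rho> * cos (t - s))) + exp (- (r * \<rho> * sin (t - s))) +
      exp (r * \<rho> * cos (t - s)) + exp (r * \<rho> * sin (t - s)))"
    by (simp add: f distrib_left del: One_nat_def)
  also have "\<dots> = exp (- ?E / 2) * (2 * (cosh (r * \<rho> * cos (t - s)) + cosh (r * \<rho> * sin (t - s))))"
    by (simp add: cosh_def add_divide_distrib)
  finally show ?thesis .
qed

text \<open>The reflected angle is \<open>s + t - u\<close>; its difference with \<open>s\<close> is
  \<open>t - u\<close>, and the closed form is even in the difference of angles.\<close>

lemma gauss_sum_reflection: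
  fixes z :: "real^'n"
  assumes "i \<noteq> j"
  shows "gauss_sum i j \<rho> w s (reflection i j ((s + t) / 2) z) = gauss_sum i j \<rho> w t z"
proof -
  obtain r u where z: "polar i j r u z = z"
    using polar_decomposition[OF assms] by blast
  have m: "2 * ((s + t) / 2) = s + t" by simp
  have "cos (s + t - u - s) = cos (u - t)" "sin (s + t - u - s) = - sin (u - t)"
    using cos_minus[of "u - t"] sin_minus[of "u - t"] by simp_all
  then show ?thesis
    using gauss_sum_polar[OF assms, of \<rho> w s r "s + t - u" z]
      gauss_sum_polar[OF assms, of \<rho> w t r u z]
      reflection_polar[OF assms, of "(s + t) / 2" r u z, unfolded m]
    unfolding z by simp
qed

text \<open>
  The sign of \<open>gauss_sum t - gauss_sum s\<close> at \<open>z\<close> tells which of \<open>z\<close> and its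
  mirror image is deeper in a Schur-square-convex set: both signs are that of
  \<open>sin (4 * (u - (s + t) / 2))\<close>, where \<open>u\<close> is the angle of \<open>z\<close>.
\<close>

lemma gauss_sum_sign:
  fixes z :: "real^'n"
  assumes "i \<noteq> j" "0 < \<rho>" "0 \<le> s" "s < t" "t \<le> pi / 4"
  defines "q \<equiv> \<lambda>z::real^'n. ((z $ i)\<^sup>2 - (z $ j)\<^sup>2)\<^sup>2" and "\<sigma> \<equiv> reflection i j ((s + t) / 2)"
  shows "gauss_sum i j \<rho> w s z < gauss_sum i j \<rho> w t z \<longleftrightarrow> q z < q (\<sigma> z)"
    and "gauss_sum i j \<rho> w t z < gauss_sum i j \<rho> w s z \<longleftrightarrow> q (\<sigma> z) < q z"
proof -
  obtain r u where r: "0 \<le> r" and z: "polar i j r u z = z"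
    using polar_decomposition[OF assms(1)] by blast
  \<comment> \<open>The common sine factor of \<open>d1\<close>, which compares the kernels, and
    \<open>d2\<close>, which compares \<open>z\<close> with its mirror image.\<close>
  define \<tau> where "\<tau> = sin (2 * (2 * u - (s + t)))"
  define E where "E = exp (- (r\<^sup>2 + \<rho>\<^sup>2 + (\<Sum>k\<in>UNIV - {i, j}. (z $ k + w $ k)\<^sup>2)) / 2) * 2"
  have "E > 0" by (simp add: E_def)
  have g: "gauss_sum i j \<rho> w x z = E * (cosh (r * \<rho> * cos (u - x)) + cosh (r * \<rho> * sin (u - x)))" for x
    using gauss_sum_polar[OF assms(1), of \<rho> w x r u z] unfolding z E_def by simp
  have m: "2 * ((s + t) / 2) = s + t" by simp
  have q: "q z = (r\<^sup>2 * cos (2 * u))\<^sup>2" "q (\<sigma> z) = (r\<^sup>2 * cos (2 * (s + t - u)))\<^sup>2"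
    using polar_squared_diff[OF assms(1), of r u z] polar_squared_diff[OF assms(1), of r "s + t - u" z]
      reflection_polar[OF assms(1), of "(s + t) / 2" r u z, unfolded m]
    unfolding z by (simp_all add: q_def \<sigma>_def)
  \<comment> \<open>The strict inequality \<open>s < t\<close> keeps \<open>s + t\<close> below
    \<open>pi / 2\<close>, hence the second sine positive.\<close>
  have pos: "0 < sin (2 * (t - s))" "0 < sin (2 * (s + t))"
    using assms by (intro sin_gt_zero; simp)+
  have d1: "(cos (2 * (u - t)))\<^sup>2 - (cos (2 * (u - s)))\<^sup>2 = \<tau> * sin (2 * (t - s))"
    using cos_double_squared_diff[of "u - t" "u - s"] by (simp add: \<tau>_def algebra_simps)
  have d2: "(cos (2 * (s + t - u)))\<^sup>2 - (cos (2 * u))\<^sup>2 = \<tau> * sin (2 * (s + t))"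
    using cos_double_squared_diff[of "s + t - u" u] by (simp add: \<tau>_def algebra_simps)
  have "(gauss_sum i j \<rho> w s z < gauss_sum i j \<rho> w t z \<longleftrightarrow> q z < q (\<sigma> z)) \<and>
    (gauss_sum i j \<rho> w t z < gauss_sum i j \<rho> w s z \<longleftrightarrow> q (\<sigma> z) < q z)"
  proof (cases "r = 0")
    case True
    then show ?thesis by (simp add: g q)
  next
    case False
    then have c: "0 < r * \<rho>" "0 < r" using r assms(2) by simp_all
    note less = cosh_circle_less[OF c(1)]
    have ql: "q z < q (\<sigma> z) \<longleftrightarrow> (cos (2 * u))\<^sup>2 < (cos (2 * (s + t - u)))\<^sup>2"
      "q (\<sigma> z) < q z \<longleftrightarrow> (cos (2 * (s + t - u)))\<^sup>2 < (cos (2 * u))\<^sup>2"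
      using c by (simp_all add: q power_mult_distrib)
    consider "\<tau> > 0" | "\<tau> < 0" | "\<tau> = 0" by linarith
    then show ?thesis
    proof cases
      case 1
      then have "(cos (2 * (u - s)))\<^sup>2 < (cos (2 * (u - t)))\<^sup>2" "(cos (2 * u))\<^sup>2 < (cos (2 * (s + t - u)))\<^sup>2"
        using d1 d2 mult_pos_pos[OF 1 pos(1)] mult_pos_pos[OF 1 pos(2)] by linarith+
      then show ?thesis
        using less[of "u - s" "u - t"] \<open>E > 0\<close> unfolding ql g by simp
    next
      case 2
      then have "(cos (2 * (u - t)))\<^sup>2 < (cos (2 * (u - s)))\<^sup>2" "(cos (2 * (s + t - u)))\<^sup>2 < (cos (2 * u))\<^sup>2"
        using d1 d2 mult_neg_pos[OF 2 pos(1)] mult_neg_pos[OF 2 pos(2)] by linarith+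
      then show ?thesis
        using less[of "u - t" "u - s"] \<open>E > 0\<close> unfolding ql g by simp
    next
      case 3
      then have e: "(cos (2 * (u - t)))\<^sup>2 = (cos (2 * (u - s)))\<^sup>2" "(cos (2 * (s + t - u)))\<^sup>2 = (cos (2 * u))\<^sup>2"
        using d1 d2 by simp_all
      \<comment> \<open>Equal or opposite cosines of the doubled angles mean that the squares of
        cosine and sine are equal or exchanged, and \<open>cosh\<close> depends only on the square
        of its argument.\<close>
      have sq: "(sin (u - x))\<^sup>2 = (1 - cos (2 * (u - x))) / 2" "(cos (u - x))\<^sup>2 = (1 + cos (2 * (u - x))) / 2" for x
        unfolding cos_double by (simp_all add: sin_squared_eq)
      have ca: "cosh (r * \<rho> * y) = cosh (r * \<rho> * sqrt (y\<^sup>2))" for y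
        by (cases "y \<ge> 0") simp_all
      have "cosh (r * \<rho> * cos (u - t)) + cosh (r * \<rho> * sin (u - t))
          = cosh (r * \<rho> * cos (u - s)) + cosh (r * \<rho> * sin (u - s))"
        using e(1)[unfolded power2_eq_iff]
        by (auto simp only: ca[of "cos _"] ca[of "sin _"] sq diff_minus_eq_add add_uminus_conv_diff add.commute)
      then show ?thesis unfolding ql g using e(2) by simp
    qed
  qed
  then show "gauss_sum i j \<rho> w s z < gauss_sum i j \<rho> w t z \<longleftrightarrow> q z < q (\<sigma> z)"
    and "gauss_sum i j \<rho> w t z < gauss_sum i j \<rho> w s z \<longleftrightarrow> q (\<sigma> z) < q z" by blast+
qed

section \<open>Points of density of Schur-square-convex sets\<close>

lemma schur2_convex_sets: "schur2_convex A \<Longrightarrow> A \<in> sets lebesgue"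
  and schur2_convexD:
    "schur2_convex A \<Longrightarrow> z \<in> A \<Longrightarrow> majorizes (vec_square z) (vec_square w) \<Longrightarrow> w \<in> A"
  by (simp_all add: schur2_convex_iff)

lemma schur2_convex_pair:
  fixes z w :: "real^'n"
  assumes A: "schur2_convex A" and "z \<in> A" "i \<noteq> j"
    and off: "\<And>k. k \<noteq> i \<Longrightarrow> k \<noteq> j \<Longrightarrow> w $ k = z $ k"
    and s: "(w $ i)\<^sup>2 + (w $ j)\<^sup>2 = (z $ i)\<^sup>2 + (z $ j)\<^sup>2"
    and d: "((w $ i)\<^sup>2 - (w $ j)\<^sup>2)\<^sup>2 \<le> ((z $ i)\<^sup>2 - (z $ j)\<^sup>2)\<^sup>2"
  shows "w \<in> A"
proof (rule schur2_convexD[OF A \<open>z \<in> A\<close>], rule majorizes_pairI[OF \<open>i \<noteq> j\<close>])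
  show "\<bar>vec_square w $ i - vec_square w $ j\<bar> \<le> \<bar>vec_square z $ i - vec_square z $ j\<bar>"
    using d by (simp add: vec_square_def abs_le_square_iff)
qed (use s off in \<open>simp_all add: vec_square_def\<close>)

text \<open>A signed permutation of the coordinates whenever \<open>s\<close> takes only the values
  1 and -1.\<close>

definition monomial :: "('n \<Rightarrow> real) \<Rightarrow> ('n \<Rightarrow> 'n) \<Rightarrow> real^'n \<Rightarrow> real^'n" where
  "monomial s p z = (\<chi> k. s k * z $ p k)"

lemma monomial_orthogonal:
  fixes p :: "'n::finite \<Rightarrow> 'n"
  assumes p: "bij p" and s: "\<And>k. (s k)\<^sup>2 = 1"
  shows "orthogonal_transformation (monomial s p)"
  unfolding orthogonal_transformation
proof (intro conjI allI)
  show "linear (monomial s p)"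
    by (rule linearI) (simp_all add: monomial_def vec_eq_iff algebra_simps)
  fix v :: "real^'n"
  have "(\<Sum>k\<in>UNIV. (v $ p k)\<^sup>2) = (\<Sum>k\<in>UNIV. (v $ k)\<^sup>2)"
    using p by (intro sum.reindex_bij_betw)
  then show "norm (monomial s p v) = norm v"
    by (simp add: norm_vec_def L2_set_def monomial_def power_mult_distrib s)
qed

lemma schur2_convex_permuted:
  fixes z w :: "real^'n"
  assumes A: "schur2_convex A" and p: "bij p" and w: "\<And>k. (w $ k)\<^sup>2 = (z $ p k)\<^sup>2"
  shows "w \<in> A \<longleftrightarrow> z \<in> A"
proof -
  have w': "vec_square w = (\<chi> k. vec_square z $ p k)"
    by (simp add: vec_square_def w)
  have z': "vec_square z = (\<chi> k. vec_square w $ inv p k)"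
    using p by (simp add: vec_square_def w bij_inv_eq_iff vec_eq_iff surj_f_inv_f bij_is_surj)
  have "majorizes (vec_square z) (vec_square w)"
    unfolding w' by (rule majorizes_permute[OF p])
  moreover have "majorizes (vec_square w) (vec_square z)"
    unfolding z' by (rule majorizes_permute[OF bij_imp_bij_inv[OF p]])
  ultimately show ?thesis
    using schur2_convexD[OF A] by blast
qed

text \<open>Numbers with equal squares agree up to sign. A relation between squares thus becomes an
  orthogonal map, to which the invariance of Lebesgue measure applies.\<close>

lemma monomial_witness:
  fixes z w :: "real^'n"
  assumes "\<And>k. (w $ k)\<^sup>2 = (z $ p k)\<^sup>2"
  obtains s where "\<And>k. (s k)\<^sup>2 = (1::real)" "monomial s p z = w"
proof
  define s where "s k = (if w $ k = z $ p k then 1 else - 1 :: real)" for k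
  show "(s k)\<^sup>2 = 1" for k by (simp add: s_def)
  show "monomial s p z = w"
    using assms unfolding monomial_def s_def vec_eq_iff power2_eq_iff by fastforce
qed

lemma schur2_convex_monomial:
  assumes "schur2_convex A" "bij p" "\<And>k. (s k)\<^sup>2 = 1"
  shows "monomial s p z \<in> A \<longleftrightarrow> z \<in> A"
  using assms by (intro schur2_convex_permuted) (auto simp: monomial_def power_mult_distrib)

lemma density_set_permuted:
  fixes z w :: "real^'n"
  assumes A: "schur2_convex A" and p: "bij p" and w: "\<And>k. (w $ k)\<^sup>2 = (z $ p k)\<^sup>2"
  shows "w \<in> density_set A \<longleftrightarrow> z \<in> density_set A"
proof -
  obtain s where s: "\<And>k. (s k)\<^sup>2 = (1::real)" "monomial s p z = w"
    using monomial_witness[OF w] by blast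
  have "monomial s p -` A = A"
    using schur2_convex_monomial[where s = s, OF A p s(1)] by auto
  then show ?thesis
    using density_set_orthogonal[OF monomial_orthogonal[where s = s, OF p s(1)] schur2_convex_sets[OF A], of z]
    by (simp add: s(2))
qed

text \<open>If the gaps are equal, \<open>w\<close> arises from \<open>z\<close> by a signed
  permutation, an exact symmetry of \<open>A\<close>. If the gap at \<open>w\<close> is strictly
  smaller, the rotation taking \<open>z\<close> to \<open>w\<close> shrinks the gap on a whole ball
  around \<open>z\<close> by continuity; it maps the part of \<open>A\<close> in that ball into
  \<open>A\<close>, and \<open>z\<close> is a density point of the preimage of
  \<open>A\<close>.\<close>

lemma density_set_pair:
  fixes z w :: "real^'n"
  assumes A: "schur2_convex A" and z: "z \<in> density_set A" and "i \<noteq> j"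
    and off: "\<And>k. k \<noteq> i \<Longrightarrow> k \<noteq> j \<Longrightarrow> w $ k = z $ k"
    and s: "(w $ i)\<^sup>2 + (w $ j)\<^sup>2 = (z $ i)\<^sup>2 + (z $ j)\<^sup>2"
    and d: "((w $ i)\<^sup>2 - (w $ j)\<^sup>2)\<^sup>2 \<le> ((z $ i)\<^sup>2 - (z $ j)\<^sup>2)\<^sup>2"
  shows "w \<in> density_set A"
proof (cases "((w $ i)\<^sup>2 - (w $ j)\<^sup>2)\<^sup>2 = ((z $ i)\<^sup>2 - (z $ j)\<^sup>2)\<^sup>2")
  case True
  then have "(w $ i)\<^sup>2 - (w $ j)\<^sup>2 = (z $ i)\<^sup>2 - (z $ j)\<^sup>2 \<or>
      (w $ i)\<^sup>2 - (w $ j)\<^sup>2 = - ((z $ i)\<^sup>2 - (z $ j)\<^sup>2)"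
    by (simp only: power2_eq_iff)
  then have "(w $ i)\<^sup>2 = (z $ i)\<^sup>2 \<and> (w $ j)\<^sup>2 = (z $ j)\<^sup>2 \<or>
      (w $ i)\<^sup>2 = (z $ j)\<^sup>2 \<and> (w $ j)\<^sup>2 = (z $ i)\<^sup>2"
    using s by linarith
  then show ?thesis
  proof
    assume *: "(w $ i)\<^sup>2 = (z $ i)\<^sup>2 \<and> (w $ j)\<^sup>2 = (z $ j)\<^sup>2"
    have "(w $ k)\<^sup>2 = (z $ id k)\<^sup>2" for k
      using * off[of k] by (cases "k = i"; cases "k = j") auto
    then show ?thesis
      using density_set_permuted[OF A bij_id] z by blast
  next
    assume *: "(w $ i)\<^sup>2 = (z $ j)\<^sup>2 \<and> (w $ j)\<^sup>2 = (z $ i)\<^sup>2"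
    have "(w $ k)\<^sup>2 = (z $ Transposition.transpose i j k)\<^sup>2" for k
      using * off[of k] by (cases "k = i"; cases "k = j") auto
    then show ?thesis
      using density_set_permuted[OF A bij_transpose] z by blast
  qed
next
  case False
  obtain r t where r: "0 \<le> r" "polar i j r t z = z"
    by (rule polar_decomposition[OF \<open>i \<noteq> j\<close>])
  obtain r' t' where r': "0 \<le> r'" "polar i j r' t' w = w"
    by (rule polar_decomposition[OF \<open>i \<noteq> j\<close>])
  have "r'\<^sup>2 = r\<^sup>2"
    using polar_squared_sum[OF \<open>i \<noteq> j\<close>, of r' t' w] polar_squared_sum[OF \<open>i \<noteq> j\<close>, of r t z] s
    unfolding r(2) r'(2) by simp
  then have "r' = r" using r r' by simp
  define T where "T = rotation i j (t' - t)"
  have T: "orthogonal_transformation T"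
    by (simp add: T_def rotation_orthogonal[OF \<open>i \<noteq> j\<close>])
  have "T z = polar i j r t' z"
    using rotation_polar[OF \<open>i \<noteq> j\<close>, of "t' - t" r t z] by (simp add: T_def r)
  also have "\<dots> = polar i j r t' w"
    using off by (simp add: polar_def vec_eq_iff)
  also have "\<dots> = w" using r' \<open>r' = r\<close> by simp
  finally have Tz: "T z = w" .
  define q where "q = (\<lambda>z :: real^'n. ((z $ i)\<^sup>2 - (z $ j)\<^sup>2)\<^sup>2)"
  have "continuous_on UNIV T"
    using T orthogonal_transformation_linear linear_continuous_on linear_conv_bounded_linear by blast
  then have "open {u. q (T u) < q u}"
    unfolding q_def by (intro open_Collect_less continuous_intros) auto
  moreover have "z \<in> {u. q (T u) < q u}"
    using False d by (simp add: Tz q_def)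
  ultimately obtain e where e: "0 < e" "ball z e \<subseteq> {u. q (T u) < q u}"
    by (meson openE)
  have TA: "T u \<in> A" if "u \<in> ball z e" "u \<in> A" for u
  proof (rule schur2_convex_pair[OF A \<open>u \<in> A\<close> \<open>i \<noteq> j\<close>])
    obtain a b where u: "polar i j a b u = u"
      using polar_decomposition[OF \<open>i \<noteq> j\<close>] by blast
    have Tu: "T u = polar i j a (b + (t' - t)) u"
      using rotation_polar[OF \<open>i \<noteq> j\<close>, of "t' - t" a b u] by (simp add: T_def u)
    show "T u $ k = u $ k" if "k \<noteq> i" "k \<noteq> j" for k
      using that by (simp add: Tu polar_def)
    show "(T u $ i)\<^sup>2 + (T u $ j)\<^sup>2 = (u $ i)\<^sup>2 + (u $ j)\<^sup>2"
      using polar_squared_sum[OF \<open>i \<noteq> j\<close>, of a b u] polar_squared_sum[OF \<open>i \<noteq> j\<close>, of a _ u]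
      by (simp add: Tu u)
    show "((T u $ i)\<^sup>2 - (T u $ j)\<^sup>2)\<^sup>2 \<le> ((u $ i)\<^sup>2 - (u $ j)\<^sup>2)\<^sup>2"
      using e(2) that(1) by (auto simp: q_def)
  qed
  have "T -` A \<in> sets lebesgue"
    using measurable_sets[OF lebesgue_distr_orthogonal(1)[OF T] schur2_convex_sets[OF A]] by simp
  then have "z \<in> density_set (T -` A)"
    using TA by (intro density_set_local_mono[OF z e(1)]) auto
  then show ?thesis
    using density_set_orthogonal[OF T schur2_convex_sets[OF A], of z] by (simp add: Tz)
qed

text \<open>Membership along the circle passes from one angle to any other with a smaller or equal
  \<open>(cos (2 * t))\<^sup>2\<close>. This yields evenness, the period \<open>pi / 2\<close> and
  the monotonicity on \<open>[0, pi / 4]\<close> together.\<close>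

lemma density_set_circle_const:
  fixes z w :: "real^'n"
  assumes A: "schur2_convex A" and "i \<noteq> j" and \<mu>: "0 < \<mu>" "\<mu> < pi / 4"
    and refl: "\<And>z. reflection i j \<mu> z \<in> density_set A \<longleftrightarrow> z \<in> density_set A"
    and off: "\<And>k. k \<noteq> i \<Longrightarrow> k \<noteq> j \<Longrightarrow> w $ k = z $ k"
    and s: "(w $ i)\<^sup>2 + (w $ j)\<^sup>2 = (z $ i)\<^sup>2 + (z $ j)\<^sup>2"
  shows "w \<in> density_set A \<longleftrightarrow> z \<in> density_set A"
proof -
  obtain r t where r: "0 \<le> r" "polar i j r t z = z"
    by (rule polar_decomposition[OF \<open>i \<noteq> j\<close>])
  obtain r' t' where r': "0 \<le> r'" "polar i j r' t' w = w"
    by (rule polar_decomposition[OF \<open>i \<noteq> j\<close>])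
  have "r'\<^sup>2 = r\<^sup>2"
    using polar_squared_sum[OF \<open>i \<noteq> j\<close>, of r' t' w] polar_squared_sum[OF \<open>i \<noteq> j\<close>, of r t z] s
    unfolding r(2) r'(2) by simp
  then have "r' = r" using r r' by simp
  have w: "polar i j r t' z = w"
    using off r'(2) \<open>r' = r\<close> by (simp add: polar_def vec_eq_iff) metis
  define f where "f t = (polar i j r t z \<in> density_set A)" for t
  have mono: "f b" if "f a" "(cos (2 * b))\<^sup>2 \<le> (cos (2 * a))\<^sup>2" for a b
    unfolding f_def
  proof (rule density_set_pair[OF A _ \<open>i \<noteq> j\<close>])
    show "polar i j r a z \<in> density_set A" using that(1) by (simp add: f_def)
    show "polar i j r b z $ k = polar i j r a z $ k" if "k \<noteq> i" "k \<noteq> j" for k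
      using that by (simp add: polar_def)
    show "(polar i j r b z $ i)\<^sup>2 + (polar i j r b z $ j)\<^sup>2 = (polar i j r a z $ i)\<^sup>2 + (polar i j r a z $ j)\<^sup>2"
      by (simp add: polar_squared_sum[OF \<open>i \<noteq> j\<close>])
    show "((polar i j r b z $ i)\<^sup>2 - (polar i j r b z $ j)\<^sup>2)\<^sup>2
        \<le> ((polar i j r a z $ i)\<^sup>2 - (polar i j r a z $ j)\<^sup>2)\<^sup>2"
      unfolding polar_squared_diff[OF \<open>i \<noteq> j\<close>] using that(2)
      by (simp add: power_mult_distrib mult_left_mono)
  qed
  have "f t' = f t"
  proof (rule periodic_reflection_const[where \<mu> = \<mu>])
    show "f (- t) = f t" for t
      using mono[of t "- t"] mono[of "- t" t] by auto
    have "cos (2 * (t + pi / 2)) = - cos (2 * t)" for t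
      using cos_periodic_pi[of "2 * t"] by (simp add: algebra_simps)
    then show "f (t + pi / 2) = f t" for t
      using mono[of t "t + pi / 2"] mono[of "t + pi / 2" t] by (metis order_refl power2_minus)
    show "f (2 * \<mu> - t) = f t" for t
      using refl[of "polar i j r t z"] by (simp add: f_def reflection_polar[OF \<open>i \<noteq> j\<close>])
    show "f t" if "0 \<le> s" "s \<le> t" "t \<le> pi / 4" "f s" for s t
      using that by (intro mono[OF \<open>f s\<close>] power_mono cos_ge_zero) (auto simp: cos_mono_le_eq)
  qed (use \<mu> in auto)
  then show ?thesis
    by (simp add: f_def w r)
qed

text \<open>Circles in coordinate planes connect a sphere: a quantity constant on them is unchanged
  while the coordinates are emptied one by one into coordinate \<open>i\<close>, with the norm
  preserved.\<close>

lemma collapse_to_axis: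
  fixes f :: "real^'n \<Rightarrow> 'b"
  assumes "i \<noteq> j"
    and pair: "\<And>i j (z :: real^'n) w. i \<noteq> j \<Longrightarrow> (\<And>k. k \<noteq> i \<Longrightarrow> k \<noteq> j \<Longrightarrow> w $ k = z $ k) \<Longrightarrow>
      (w $ i)\<^sup>2 + (w $ j)\<^sup>2 = (z $ i)\<^sup>2 + (z $ j)\<^sup>2 \<Longrightarrow> f w = f z"
  shows "f z = f (axis i (norm z))"
proof (induction "card {k. k \<noteq> i \<and> z $ k \<noteq> 0}" arbitrary: z rule: less_induct)
  case less
  show ?case
  proof (cases "\<exists>k. k \<noteq> i \<and> z $ k \<noteq> 0")
    case True
    then obtain k where k: "k \<noteq> i" "z $ k \<noteq> 0" by blast
    define w where "w = (\<chi> l. if l = i then sqrt ((z $ i)\<^sup>2 + (z $ k)\<^sup>2) else if l = k then 0 else z $ l)"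
    have s: "(w $ i)\<^sup>2 + (w $ k)\<^sup>2 = (z $ i)\<^sup>2 + (z $ k)\<^sup>2"
      using k by (simp add: w_def)
    have "f w = f z"
      using k s by (intro pair[of i k]) (auto simp: w_def)
    moreover have "{l. l \<noteq> i \<and> w $ l \<noteq> 0} \<subset> {l. l \<noteq> i \<and> z $ l \<noteq> 0}"
      using k by (auto simp: w_def)
    then have "f w = f (axis i (norm w))"
      by (intro less psubset_card_mono) auto
    moreover have "(norm w)\<^sup>2 = (norm z)\<^sup>2"
      using norm_squared_pair[OF k(1)[symmetric], of w] norm_squared_pair[OF k(1)[symmetric], of z] s
      by (simp add: w_def)
    then have "norm w = norm z" by simp
    ultimately show ?thesis by simp
  next
    case False
    then have z: "z $ k = 0" if "k \<noteq> i" for k using that by blast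
    have "(norm z)\<^sup>2 = (z $ i)\<^sup>2"
      using norm_squared_pair[OF \<open>i \<noteq> j\<close>, of z] z \<open>i \<noteq> j\<close> by simp
    \<comment> \<open>Only coordinate \<open>i\<close> is left, and the last move along a circle
      corrects its sign.\<close>
    then show ?thesis
      using z \<open>i \<noteq> j\<close> by (intro pair[OF \<open>i \<noteq> j\<close>]) (auto simp: axis_def)
  qed
qed

text \<open>The reflection acts in one plane only. Permutation symmetry of the density set carries
  the constancy on circles from this plane to all others.\<close>

lemma density_set_sphere_const:
  fixes z w :: "real^'n"
  assumes A: "schur2_convex A" and "i \<noteq> j" and \<mu>: "0 < \<mu>" "\<mu> < pi / 4"
    and refl: "\<And>z. reflection i j \<mu> z \<in> density_set A \<longleftrightarrow> z \<in> density_set A"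
    and norm: "norm z = norm w"
  shows "w \<in> density_set A \<longleftrightarrow> z \<in> density_set A"
proof -
  have pair: "(w \<in> density_set A) = (z \<in> density_set A)"
    if kl: "k \<noteq> l" and off: "\<And>m. m \<noteq> k \<Longrightarrow> m \<noteq> l \<Longrightarrow> w $ m = z $ m"
      and s: "(w $ k)\<^sup>2 + (w $ l)\<^sup>2 = (z $ k)\<^sup>2 + (z $ l)\<^sup>2" for k l and z w :: "real^'n"
  proof -
    \<comment> \<open>The inner transposition sends \<open>i\<close> to \<open>k\<close>; the outer
      one then sends the current image of \<open>j\<close> to \<open>l\<close> and fixes
      \<open>k\<close>.\<close>
    define p where "p = Transposition.transpose (Transposition.transpose i k j) l \<circ> Transposition.transpose i k"
    have ne: "k \<noteq> Transposition.transpose i k j"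
      using \<open>i \<noteq> j\<close> by (auto simp: Transposition.transpose_def)
    have p: "p i = k" "p j = l" "bij p"
      using transpose_apply_other[OF ne kl] by (simp_all add: p_def bij_comp)
    have inj: "p m = k \<longleftrightarrow> m = i" "p m = l \<longleftrightarrow> m = j" for m
      using p by (auto simp: bij_def inj_def)
    have perm: "((\<chi> m. u $ p m) \<in> density_set A) = (u \<in> density_set A)" for u
      by (rule density_set_permuted[OF A p(3)]) simp
    have "((\<chi> m. w $ p m) \<in> density_set A) = ((\<chi> m. z $ p m) \<in> density_set A)"
      using off s by (intro density_set_circle_const[OF A \<open>i \<noteq> j\<close> \<mu> refl]) (auto simp: p inj)
    then show ?thesis by (simp add: perm)
  qed
  have "(u \<in> density_set A) = (axis i (norm u) \<in> density_set A)" for u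
    by (rule collapse_to_axis[OF \<open>i \<noteq> j\<close>, where f = "\<lambda>z. z \<in> density_set A"]) (rule pair)
  from this[of w] this[of z] show ?thesis
    using norm by simp
qed

section \<open>Comparison of Gaussian integrals\<close>

lemma integrable_gauss: "integrable lborel (gauss :: real^'n \<Rightarrow> real)"
proof -
  interpret product_sigma_finite "\<lambda>_ :: real^'n. lborel :: real measure" ..
  have one: "integrable lborel (\<lambda>x::real. exp (- x\<^sup>2 / 2))"
  proof -
    have "integrable lborel (\<lambda>x. sqrt (2 * pi) * std_normal_density x)"
      by (intro integrable_mult_right integrable_normal_density) simp
    then show ?thesis
      by (simp add: std_normal_density_def)
  qed
  have "integrable (\<Pi>\<^sub>M b\<in>Basis. lborel) (\<lambda>f :: real^'n \<Rightarrow> real. \<Prod>b\<in>(Basis :: (real^'n) set). exp (- (f b)\<^sup>2 / 2))"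
    by (rule product_integrable_prod[where f = "\<lambda>_ x. exp (- x\<^sup>2 / 2)", OF finite_Basis one])
  moreover have "gauss (\<Sum>b\<in>Basis. f b *\<^sub>R b) = (\<Prod>b\<in>(Basis :: (real^'n) set). exp (- (f b)\<^sup>2 / 2))" for f
  proof -
    have "(norm (\<Sum>b\<in>(Basis :: (real^'n) set). f b *\<^sub>R b))\<^sup>2 = (\<Sum>b\<in>(Basis :: (real^'n) set). (f b)\<^sup>2)"
      unfolding power2_norm_eq_inner
      by (subst euclidean_inner) (simp add: power2_eq_square del: inner_axis)
    then show ?thesis
      by (simp add: gauss_def exp_sum sum_divide_distrib flip: sum_negf)
  qed
  ultimately have "integrable (\<Pi>\<^sub>M b\<in>Basis. lborel) (\<lambda>f :: real^'n \<Rightarrow> real. gauss (\<Sum>b\<in>Basis. f b *\<^sub>R b))"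
    by simp
  moreover have "(\<lambda>f. \<Sum>b\<in>Basis. f b *\<^sub>R b) \<in> (\<Pi>\<^sub>M b\<in>(Basis :: (real^'n) set). lborel) \<rightarrow>\<^sub>M borel"
    by measurable
  ultimately have "integrable (distr (\<Pi>\<^sub>M b\<in>Basis. lborel) borel (\<lambda>f. \<Sum>b\<in>Basis. f b *\<^sub>R b)) (gauss :: real^'n \<Rightarrow> real)"
    using integrable_distr_eq[OF _ gauss_measurable] by blast
  moreover have "(lborel :: (real^'n) measure) = distr (\<Pi>\<^sub>M b\<in>Basis. lborel) borel (\<lambda>f. \<Sum>b\<in>Basis. f b *\<^sub>R b)"
    by (rule lborel_eq)
  ultimately show ?thesis by (simp only:)
qed

text \<open>Up to normalization, the probability of \<open>A + x\<close>, with the translation moved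
  from the set to the density.\<close>

definition gauss_mass :: "(real^'n) set \<Rightarrow> real^'n \<Rightarrow> real" where
  "gauss_mass A x = (\<integral>z. indicator A z * gauss (z + x) \<partial>lebesgue)"

lemma integrable_gauss_shift:
  fixes x :: "real^'n"
  shows "integrable lebesgue (\<lambda>z. gauss (z + x))"
proof -
  have "integrable (distr lborel borel ((+) x)) (gauss :: real^'n \<Rightarrow> real)"
    using integrable_gauss by (simp add: lborel_distr_plus)
  then have "integrable lborel (\<lambda>z. gauss (x + z))"
    by (subst (asm) integrable_distr_eq) auto
  then show ?thesis
    by (simp add: integrable_completion add.commute)
qed

lemma integrable_gauss_mass:
  assumes "A \<in> sets lebesgue"
  shows "integrable lebesgue (\<lambda>z. indicator A z * gauss (z + x))"
  using integrable_mult_indicator[OF assms integrable_gauss_shift[of x]] by simp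

lemma gauss_mass_nonneg: "0 \<le> gauss_mass A x"
  unfolding gauss_mass_def by (intro Bochner_Integration.integral_nonneg) (simp add: less_imp_le[OF gauss_pos])

lemma gauss_mass_orthogonal:
  assumes A: "A \<in> sets lebesgue" and T: "orthogonal_transformation T" and TA: "\<And>z. T z \<in> A \<longleftrightarrow> z \<in> A"
  shows "gauss_mass A (T x) = gauss_mass A x"
proof -
  have "gauss_mass A (T x) = (\<integral>z. indicator A (T z) * gauss (T z + T x) \<partial>lebesgue)"
    unfolding gauss_mass_def using A
    by (intro integral_lebesgue_orthogonal[OF T, symmetric] borel_measurable_integrable integrable_gauss_mass)
  also have "\<dots> = gauss_mass A x"
    unfolding gauss_mass_def
    by (intro Bochner_Integration.integral_cong)
       (auto simp: indicator_def TA gauss_orthogonal[OF T] linear_add[OF orthogonal_transformation_linear[OF T], symmetric])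
  finally show ?thesis .
qed

text \<open>A quarter turn permutes the squares of the coordinates and so preserves
  \<open>A\<close>; hence the four kernels in \<open>gauss_sum\<close> have the same integral over
  \<open>A\<close>.\<close>

lemma gauss_mass_gauss_sum:
  fixes A :: "(real^'n) set"
  assumes A: "schur2_convex A" and "i \<noteq> j"
  shows "integrable lebesgue (\<lambda>z. indicator A z * gauss_sum i j \<rho> w t z)"
    and "(\<integral>z. indicator A z * gauss_sum i j \<rho> w t z \<partial>lebesgue) = 4 * gauss_mass A (polar i j \<rho> t w)"
proof -
  note Am = schur2_convex_sets[OF A]
  have rot: "gauss_mass A (polar i j \<rho> (s + pi / 2) w) = gauss_mass A (polar i j \<rho> s w)" for s
    unfolding rotation_polar[OF \<open>i \<noteq> j\<close>, symmetric]
  proof (rule gauss_mass_orthogonal[OF Am rotation_orthogonal[OF \<open>i \<noteq> j\<close>]])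
    fix z :: "real^'n"
    show "rotation i j (pi / 2) z \<in> A \<longleftrightarrow> z \<in> A"
      by (rule schur2_convex_permuted[OF A bij_transpose[of i j]])
         (use \<open>i \<noteq> j\<close> in \<open>auto simp: rotation_def plane_map_def Transposition.transpose_def\<close>)
  qed
  have rots: "gauss_mass A (polar i j \<rho> (t + real m * (pi / 2)) w) = gauss_mass A (polar i j \<rho> t w)" for m
  proof (induction m)
    case (Suc m)
    then show ?case
      using rot[of "t + real m * (pi / 2)"] by (simp add: algebra_simps add_divide_distrib)
  qed simp
  have eq: "indicator A z * gauss_sum i j \<rho> w t z =
      (\<Sum>m<4. indicator A z * gauss (z + polar i j \<rho> (t + real m * (pi / 2)) w))" for z
    by (simp add: gauss_sum_def sum_distrib_left)
  show "integrable lebesgue (\<lambda>z. indicator A z * gauss_sum i j \<rho> w t z)"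
    unfolding eq by (intro Bochner_Integration.integrable_sum integrable_gauss_mass Am)
  have "(\<integral>z. indicator A z * gauss_sum i j \<rho> w t z \<partial>lebesgue)
      = (\<Sum>m<4. gauss_mass A (polar i j \<rho> (t + real m * (pi / 2)) w))"
    unfolding eq gauss_mass_def
    by (intro Bochner_Integration.integral_sum integrable_gauss_mass Am)
  then show "(\<integral>z. indicator A z * gauss_sum i j \<rho> w t z \<partial>lebesgue) = 4 * gauss_mass A (polar i j \<rho> t w)"
    unfolding rots by simp
qed

lemma continuous_gauss_sum:
  fixes w :: "real^'n"
  shows "continuous_on UNIV (gauss_sum i j \<rho> w t)"
proof -
  have "continuous_on UNIV (\<lambda>z. gauss (z + x))" for x :: "real^'n"
    by (rule continuous_on_compose2[OF continuous_gauss, where s = UNIV])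
       (auto intro: continuous_on_add continuous_on_id continuous_on_const)
  then show ?thesis
    unfolding gauss_sum_def[abs_def] by (intro continuous_on_sum)
qed

lemma gauss_mass_transfer:
  fixes A :: "(real^'n) set"
  assumes A: "schur2_convex A" and "i \<noteq> j" "0 < \<rho>" "0 \<le> s" "s < t" "t \<le> pi / 4"
  shows "gauss_mass A (polar i j \<rho> s w) \<le> gauss_mass A (polar i j \<rho> t w)"
    and "gauss_mass A (polar i j \<rho> s w) = gauss_mass A (polar i j \<rho> t w) \<Longrightarrow>
      reflection i j ((s + t) / 2) z \<in> density_set A \<longleftrightarrow> z \<in> density_set A"
proof -
  note Am = schur2_convex_sets[OF A]
  define \<sigma> where "\<sigma> = reflection i j ((s + t) / 2)"
  have \<sigma>: "orthogonal_transformation \<sigma>" "\<And>z. \<sigma> (\<sigma> z) = z"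
    by (simp_all add: \<sigma>_def reflection_orthogonal reflection_involution \<open>i \<noteq> j\<close>)
  have \<sigma>m: "\<sigma> \<in> lebesgue \<rightarrow>\<^sub>M lebesgue"
    using lebesgue_distr_orthogonal(1)[OF \<sigma>(1)] .
  define q where "q = (\<lambda>z :: real^'n. ((z $ i)\<^sup>2 - (z $ j)\<^sup>2)\<^sup>2)"
  define D where "D z = gauss_sum i j \<rho> w t z - gauss_sum i j \<rho> w s z" for z
  have D\<sigma>: "D (\<sigma> z) = - D z" for z
    using gauss_sum_reflection[OF \<open>i \<noteq> j\<close>, of \<rho> w s t z] gauss_sum_reflection[OF \<open>i \<noteq> j\<close>, of \<rho> w t s z]
    by (simp add: D_def \<sigma>_def add.commute)
  have sign: "0 < D z \<longleftrightarrow> q z < q (\<sigma> z)" "D z < 0 \<longleftrightarrow> q (\<sigma> z) < q z" for z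
    using gauss_sum_sign[OF assms(2-6), of w z] by (simp_all add: D_def q_def \<sigma>_def)
  have coords: "(\<forall>k. k \<noteq> i \<longrightarrow> k \<noteq> j \<longrightarrow> \<sigma> z $ k = z $ k) \<and> (\<sigma> z $ i)\<^sup>2 + (\<sigma> z $ j)\<^sup>2 = (z $ i)\<^sup>2 + (z $ j)\<^sup>2" for z
  proof -
    obtain a b where z: "polar i j a b z = z"
      using polar_decomposition[OF \<open>i \<noteq> j\<close>] by blast
    have \<sigma>z: "\<sigma> z = polar i j a (2 * ((s + t) / 2) - b) z"
      using reflection_polar[OF \<open>i \<noteq> j\<close>, of "(s + t) / 2" a b z] by (simp only: \<sigma>_def z)
    show ?thesis
      using polar_squared_sum[OF \<open>i \<noteq> j\<close>, of a b z] unfolding z \<sigma>z polar_squared_sum[OF \<open>i \<noteq> j\<close>]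
      by (simp add: polar_def)
  qed
  have down: "\<sigma> z \<in> A" if "z \<in> A" "q (\<sigma> z) \<le> q z" for z
    using coords[of z] that(2) by (intro schur2_convex_pair[OF A that(1) \<open>i \<noteq> j\<close>]) (auto simp: q_def)
  have up: "z \<in> A" if "\<sigma> z \<in> A" "q z \<le> q (\<sigma> z)" for z
    using down[of "\<sigma> z"] that by (simp add: \<sigma>)
  \<comment> \<open>Since \<open>D\<close> changes sign under \<open>\<sigma>\<close>, this is the
    integrand \<open>indicator A z * D z\<close> plus its composition with \<open>\<sigma>\<close>.
    Its integral is twice that of the integrand, and it is nonnegative at every point.\<close>
  define h where "h z = (indicator A z - indicator A (\<sigma> z)) * D z" for z
  have h0: "0 \<le> h z" for z
  proof -
    consider "D z = 0" | "0 < D z" | "D z < 0" by linarith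
    then show ?thesis
    proof cases
      case 2
      then have "\<sigma> z \<in> A \<longrightarrow> z \<in> A" using up[of z] sign(1)[of z] by simp
      then show ?thesis using 2 by (auto simp: h_def indicator_def)
    next
      case 3
      then have "z \<in> A \<longrightarrow> \<sigma> z \<in> A" using down[of z] sign(2)[of z] by simp
      then show ?thesis using 3 by (auto simp: h_def indicator_def)
    qed (simp add: h_def)
  qed
  let ?I = "\<integral>z. indicator A z * D z \<partial>lebesgue"
  have int: "integrable lebesgue (\<lambda>z. indicator A z * D z)"
    and I: "?I = 4 * (gauss_mass A (polar i j \<rho> t w) - gauss_mass A (polar i j \<rho> s w))"
    using gauss_mass_gauss_sum[OF A \<open>i \<noteq> j\<close>, of \<rho> w] by (simp_all add: D_def right_diff_distrib)
  have Dm: "(\<lambda>z. indicator A z * D z) \<in> borel_measurable lebesgue"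
    using int by (rule borel_measurable_integrable)
  have "integrable (distr lebesgue lebesgue \<sigma>) (\<lambda>z. indicator A z * D z)"
    using int by (simp add: lebesgue_distr_orthogonal(2)[OF \<sigma>(1)])
  then have int\<sigma>: "integrable lebesgue (\<lambda>z. indicator A (\<sigma> z) * D (\<sigma> z))"
    by (subst (asm) integrable_distr_eq[OF \<sigma>m Dm])
  have "(\<integral>z. indicator A (\<sigma> z) * D (\<sigma> z) \<partial>lebesgue) = ?I"
    by (rule integral_lebesgue_orthogonal[OF \<sigma>(1) Dm])
  moreover have h: "h z = indicator A z * D z + indicator A (\<sigma> z) * D (\<sigma> z)" for z
    by (simp add: h_def D\<sigma> left_diff_distrib)
  ultimately have hI: "integrable lebesgue h" "integral\<^sup>L lebesgue h = 2 * ?I"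
    using int int\<sigma> unfolding h by (simp_all add: h[abs_def])
  have "0 \<le> integral\<^sup>L lebesgue h"
    using h0 by (intro Bochner_Integration.integral_nonneg) auto
  then show "gauss_mass A (polar i j \<rho> s w) \<le> gauss_mass A (polar i j \<rho> t w)"
    using hI I by simp
  assume "gauss_mass A (polar i j \<rho> s w) = gauss_mass A (polar i j \<rho> t w)"
  then have "AE z in lebesgue. h z = 0"
    using integral_nonneg_eq_0_iff_AE[OF hI(1)] h0 hI(2) I by simp
  then have ae: "AE z in lebesgue. D z \<noteq> 0 \<longrightarrow> (\<sigma> z \<in> A \<longleftrightarrow> z \<in> A)"
    by eventually_elim (auto simp: h_def indicator_def split: if_splits)
  show "reflection i j ((s + t) / 2) z \<in> density_set A \<longleftrightarrow> z \<in> density_set A"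
    unfolding \<sigma>_def[symmetric]
  proof (cases "D z = 0")
    \<comment> \<open>Where \<open>D\<close> vanishes the integral gives no information, but
      \<open>z\<close> and its mirror image have the same gap there.\<close>
    case True
    then have "q (\<sigma> z) = q z" using sign[of z] by linarith
    then show "\<sigma> z \<in> density_set A \<longleftrightarrow> z \<in> density_set A"
      using coords[of z] density_set_pair[OF A _ \<open>i \<noteq> j\<close>, of z "\<sigma> z"]
        density_set_pair[OF A _ \<open>i \<noteq> j\<close>, of "\<sigma> z" z]
      by (auto simp: q_def)
  next
    case False
    \<comment> \<open>By continuity \<open>D\<close> stays nonzero on a ball around
      \<open>z\<close>, so \<open>A\<close> is \<open>\<sigma>\<close>-invariant almost everywhere
      on that ball.\<close>
    have "continuous_on UNIV D"
      using continuous_on_diff[OF continuous_gauss_sum[of i j \<rho> w t] continuous_gauss_sum[of i j \<rho> w s]]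
      by (simp add: D_def[abs_def])
    then have op: "open {z. D z \<noteq> 0}"
      by (intro open_Collect_neq continuous_on_const)
    have "z \<in> {z. D z \<noteq> 0}"
      using False by simp
    from openE[OF op this] obtain e where e: "0 < e" "ball z e \<subseteq> {z. D z \<noteq> 0}"
      by blast
    have \<sigma>A: "\<sigma> -` A \<in> sets lebesgue"
      using measurable_sets[OF \<sigma>m Am] by simp
    have near: "AE u in lebesgue. u \<in> ball z e \<longrightarrow> (\<sigma> u \<in> A \<longleftrightarrow> u \<in> A)"
      using ae by (rule eventually_mono) (use e(2) in blast)
    have "z \<in> density_set (\<sigma> -` A) \<longleftrightarrow> z \<in> density_set A"
    proof
      assume *: "z \<in> density_set (\<sigma> -` A)"
      show "z \<in> density_set A"
        by (rule density_set_local_mono[OF * e(1) Am], rule eventually_mono[OF near]) simp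
    next
      assume *: "z \<in> density_set A"
      show "z \<in> density_set (\<sigma> -` A)"
        by (rule density_set_local_mono[OF * e(1) \<sigma>A], rule eventually_mono[OF near]) simp
    qed
    then show "\<sigma> z \<in> density_set A \<longleftrightarrow> z \<in> density_set A"
      using density_set_orthogonal[OF \<sigma>(1) Am, of z] by simp
  qed
qed

section \<open>Schur concavity\<close>

definition vec_sqrt :: "real^'n \<Rightarrow> real^'n" where
  "vec_sqrt a = (\<chi> i. sqrt (a $ i))"

lemma gauss_mass_permuted:
  fixes x :: "real^'n"
  assumes A: "schur2_convex A" and p: "bij p" and w: "\<And>k. (x $ k)\<^sup>2 = (y $ p k)\<^sup>2"
  shows "gauss_mass A x = gauss_mass A y"
proof -
  obtain s where s: "\<And>k. (s k)\<^sup>2 = (1::real)" "monomial s p y = x"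
    using monomial_witness[OF w] by blast
  show ?thesis
    using gauss_mass_orthogonal[where T = "monomial s p" and x = y, OF schur2_convex_sets[OF A]
        monomial_orthogonal[where s = s, OF p s(1)] schur2_convex_monomial[where s = s, OF A p s(1)]]
    by (simp add: s(2))
qed

text \<open>A transfer preserves \<open>a $ i + a $ j\<close>, so the square roots move on a circle
  of radius \<open>\<rho>\<close>. Coordinate \<open>i\<close> stays the larger one, which confines
  the angle to \<open>[0, pi / 4]\<close>; the shrinking difference makes it increase.\<close>

lemma transfer_angles:
  fixes a :: "real^'n"
  assumes a: "a \<in> nonneg_orthant" and "i \<noteq> j" "0 < d" "a $ j + d \<le> a $ i - d"
  obtains \<rho> s t where "0 < \<rho>" "0 \<le> s" "s < t" "t \<le> pi / 4"
    "vec_sqrt a = polar i j \<rho> s (vec_sqrt a)"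
    "vec_sqrt (transfer i j d a) = polar i j \<rho> t (vec_sqrt a)"
proof -
  have aj: "0 \<le> a $ j" using a by (simp add: nonneg_orthant_def)
  define \<rho> where "\<rho> = sqrt (a $ i + a $ j)"
  have \<rho>: "0 < \<rho>" "\<rho>\<^sup>2 = a $ i + a $ j"
    using assms aj by (simp_all add: \<rho>_def)
  have angle: "\<exists>s. 0 \<le> s \<and> s \<le> pi / 4 \<and> sqrt u = \<rho> * cos s \<and> sqrt v = \<rho> * sin s \<and> u - v = \<rho>\<^sup>2 * cos (2 * s)"
    if "0 \<le> v" "v \<le> u" "u + v = \<rho>\<^sup>2" for u v
  proof -
    have "(sqrt u / \<rho>)\<^sup>2 + (sqrt v / \<rho>)\<^sup>2 = 1"
      using that \<rho>(1) by (simp add: power_divide flip: add_divide_distrib)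
    moreover have nn: "0 \<le> sqrt u / \<rho>" "0 \<le> sqrt v / \<rho>"
      using that \<rho>(1) by simp_all
    ultimately obtain s where s: "0 \<le> s" "s \<le> pi / 2" "sqrt u / \<rho> = cos s" "sqrt v / \<rho> = sin s"
      using sincos_total_pi_half[OF nn] by blast
    then have e: "sqrt u = \<rho> * cos s" "sqrt v = \<rho> * sin s"
      using \<rho>(1) by (simp_all add: field_simps)
    have "u = (sqrt u)\<^sup>2" "v = (sqrt v)\<^sup>2" using that by simp_all
    then have diff: "u - v = \<rho>\<^sup>2 * cos (2 * s)"
      unfolding e by (simp add: cos_double power_mult_distrib right_diff_distrib)
    have "s \<le> pi / 4"
    proof (rule ccontr)
      assume "\<not> s \<le> pi / 4"
      then have "cos (2 * s) < cos (pi / 2)"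
        using s by (intro cos_monotone_0_pi) auto
      then have "\<rho>\<^sup>2 * cos (2 * s) < 0"
        using \<rho>(1) by (simp add: mult_pos_neg)
      then show False using diff that by simp
    qed
    then show ?thesis using s e diff by blast
  qed
  obtain s where s: "0 \<le> s" "s \<le> pi / 4" "sqrt (a $ i) = \<rho> * cos s" "sqrt (a $ j) = \<rho> * sin s"
      "a $ i - a $ j = \<rho>\<^sup>2 * cos (2 * s)"
    using angle[of "a $ j" "a $ i"] assms aj \<rho>(2) by auto
  obtain t where t: "0 \<le> t" "t \<le> pi / 4" "sqrt (a $ i - d) = \<rho> * cos t" "sqrt (a $ j + d) = \<rho> * sin t"
      "(a $ i - d) - (a $ j + d) = \<rho>\<^sup>2 * cos (2 * t)"
    using angle[of "a $ j + d" "a $ i - d"] assms aj \<rho>(2) by auto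
  have "\<rho>\<^sup>2 * cos (2 * t) < \<rho>\<^sup>2 * cos (2 * s)"
    using s(5) t(5) \<open>0 < d\<close> by linarith
  then have "cos (2 * t) < cos (2 * s)"
    using \<rho>(1) by simp
  then have "s < t"
    using s t by (subst (asm) cos_mono_less_eq) auto
  show thesis
  proof (rule that[OF \<rho>(1) s(1) \<open>s < t\<close> t(2)])
    show "vec_sqrt a = polar i j \<rho> s (vec_sqrt a)"
      by (auto simp: vec_eq_iff vec_sqrt_def polar_def s)
    show "vec_sqrt (transfer i j d a) = polar i j \<rho> t (vec_sqrt a)"
      using \<open>i \<noteq> j\<close> by (auto simp: vec_eq_iff vec_sqrt_def polar_def transfer_def t)
  qed
qed

lemma transfer_nonneg_orthant:
  assumes "a \<in> nonneg_orthant" "0 < d" "a $ j + d \<le> a $ i - d"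
  shows "transfer i j d a \<in> nonneg_orthant"
proof -
  have nonneg: "0 \<le> a $ k" for k
    using assms(1) by (simp add: nonneg_orthant_def)
  have "0 \<le> a $ j + d" "0 \<le> a $ i - d"
    using nonneg[of j] assms(2,3) by linarith+
  then show ?thesis
    using nonneg by (simp add: nonneg_orthant_def transfer_def)
qed

lemma permute_nonneg_orthant:
  "a \<in> nonneg_orthant \<Longrightarrow> (\<chi> i. a $ p i) \<in> nonneg_orthant"
  by (simp add: nonneg_orthant_def)

lemma gauss_mass_permute:
  assumes "schur2_convex A" "bij p" "a \<in> nonneg_orthant"
  shows "gauss_mass A (vec_sqrt (\<chi> i. a $ p i)) = gauss_mass A (vec_sqrt a)"
  using assms by (intro gauss_mass_permuted[where p = p]) (simp_all add: vec_sqrt_def)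

lemma gauss_mass_schur_concave:
  fixes a b :: "real^'n"
  assumes A: "schur2_convex A" and "majorizes a b" "a \<in> nonneg_orthant"
  shows "gauss_mass A (vec_sqrt a) \<le> gauss_mass A (vec_sqrt b)"
proof -
  \<comment> \<open>Nonnegativity is carried along inside \<open>R\<close>, since the induction rule
    provides no other information about the intermediate vectors.\<close>
  define R :: "real^'n \<Rightarrow> real^'n \<Rightarrow> bool" where "R a b \<longleftrightarrow> (a \<in> nonneg_orthant \<longrightarrow>
    b \<in> nonneg_orthant \<and> gauss_mass A (vec_sqrt a) \<le> gauss_mass A (vec_sqrt b))" for a b
  have "R a b"
    using assms(2)
  proof (rule majorizes_transfer_induct)
    show "R a (\<chi> i. a $ p i)" if "bij p" for a p
      using permute_nonneg_orthant[of a p] gauss_mass_permute[OF A that, of a] by (simp add: R_def)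
    show "R a (transfer i j d a)" if ij: "i \<noteq> j" and d: "0 < d" "a $ j + d \<le> a $ i - d" for a i j d
      unfolding R_def
    proof (intro impI conjI)
      assume a: "a \<in> nonneg_orthant"
      show "transfer i j d a \<in> nonneg_orthant"
        by (rule transfer_nonneg_orthant[OF a d])
      obtain \<rho> s t where *: "0 < \<rho>" "0 \<le> s" "s < t" "t \<le> pi / 4"
        "vec_sqrt a = polar i j \<rho> s (vec_sqrt a)"
        "vec_sqrt (transfer i j d a) = polar i j \<rho> t (vec_sqrt a)"
        by (rule transfer_angles[OF a ij d])
      show "gauss_mass A (vec_sqrt a) \<le> gauss_mass A (vec_sqrt (transfer i j d a))"
        by (rule gauss_mass_transfer(1)[OF A ij *(1-4), of "vec_sqrt a", folded *(5,6)])
    qed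
  qed (auto simp: R_def)
  then show ?thesis
    using assms(3) by (simp add: R_def)
qed

text \<open>The density set itself is the symmetric representative; it is measurable because it
  agrees almost everywhere with \<open>A\<close> and Lebesgue measure is complete.\<close>

lemma spherically_symmetric_density_set:
  fixes A :: "(real^'n) set"
  assumes A: "A \<in> sets lebesgue"
    and const: "\<And>z w :: real^'n. norm z = norm w \<Longrightarrow> w \<in> density_set A \<longleftrightarrow> z \<in> density_set A"
  shows "\<exists>B. spherically_symmetric B \<and> equivalent_sets A B"
proof (intro exI conjI)
  have ae: "AE z in lebesgue. z \<in> density_set A \<longleftrightarrow> z \<in> A"
    by (rule AE_density_set[OF A])
  have meas: "density_set A \<in> sets lebesgue"
  proof (rule completion.in_sets_AE[OF _ A])
    show "AE z in lebesgue. z \<in> A \<longleftrightarrow> z \<in> density_set A"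
      using ae by (rule eventually_mono) auto
  qed simp
  have "(indicator (density_set A) :: real^'n \<Rightarrow> real) constant_on sphere 0 r" for r
  proof (cases "sphere (0 :: real^'n) r = {}")
    case False
    then obtain z :: "real^'n" where "z \<in> sphere 0 r" by blast
    then have z: "norm z = r" by simp
    have "(indicator (density_set A) w :: real) = indicator (density_set A) z" if "w \<in> sphere 0 r" for w
      using const[of z w] that z unfolding indicator_def by simp
    then show ?thesis
      unfolding constant_on_def by blast
  qed (simp add: constant_on_def)
  then show "spherically_symmetric (density_set A)"
    using meas by (simp add: spherically_symmetric_def)
  have "AE z in lebesgue. (indicator A z :: real) = indicator (density_set A) z"
    using ae by (rule eventually_mono) (simp add: indicator_def)
  then show "equivalent_sets A (density_set A)"
    using A meas by (simp add: equivalent_sets_def)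
qed

lemma gauss_mass_strictly_schur_concave:
  fixes a b :: "real^'n"
  assumes A: "schur2_convex A" and nonsph: "\<not> (\<exists>B. spherically_symmetric B \<and> equivalent_sets A B)"
    and "strictly_majorizes a b" "a \<in> nonneg_orthant"
  shows "gauss_mass A (vec_sqrt a) < gauss_mass A (vec_sqrt b)"
proof -
  \<comment> \<open>Permutations fall under the equality alternative and transfers under the strict
    one. The disjunction is transitive, and different rearrangements exclude equality.\<close>
  define R :: "real^'n \<Rightarrow> real^'n \<Rightarrow> bool" where "R a b \<longleftrightarrow> (a \<in> nonneg_orthant \<longrightarrow>
    b \<in> nonneg_orthant \<and> (gauss_mass A (vec_sqrt a) < gauss_mass A (vec_sqrt b) \<or>
      gauss_mass A (vec_sqrt a) = gauss_mass A (vec_sqrt b) \<and>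
      decreasing_rearrangement a = decreasing_rearrangement b))" for a b
  have "majorizes a b"
    using assms(3) by (simp add: strictly_majorizes_def)
  then have "R a b"
  proof (rule majorizes_transfer_induct)
    show "R a (\<chi> i. a $ p i)" if "bij p" for a p
      using permute_nonneg_orthant[of a p] gauss_mass_permute[OF A that, of a]
      by (simp add: R_def decreasing_rearrangement_permute[OF that])
    show "R a (transfer i j d a)" if ij: "i \<noteq> j" and d: "0 < d" "a $ j + d \<le> a $ i - d" for a i j d
      unfolding R_def
    proof (intro impI conjI disjI1)
      assume a: "a \<in> nonneg_orthant"
      show "transfer i j d a \<in> nonneg_orthant"
        by (rule transfer_nonneg_orthant[OF a d])
      obtain \<rho> s t where *: "0 < \<rho>" "0 \<le> s" "s < t" "t \<le> pi / 4"
        "vec_sqrt a = polar i j \<rho> s (vec_sqrt a)"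
        "vec_sqrt (transfer i j d a) = polar i j \<rho> t (vec_sqrt a)"
        by (rule transfer_angles[OF a ij d])
      note mass = gauss_mass_transfer[OF A ij *(1-4), of "vec_sqrt a", folded *(5,6)]
      show "gauss_mass A (vec_sqrt a) < gauss_mass A (vec_sqrt (transfer i j d a))"
      proof (rule ccontr)
        assume "\<not> ?thesis"
        then have eq: "gauss_mass A (vec_sqrt a) = gauss_mass A (vec_sqrt (transfer i j d a))"
          using mass(1) by simp
        \<comment> \<open>Equality for one transfer supplies the invariance under one reflection, at
          an angle in the open interval from \<open>0\<close> to \<open>pi / 4\<close>.\<close>
        have "w \<in> density_set A \<longleftrightarrow> z \<in> density_set A" if "norm z = norm w" for z w
          using *(2-4) by (intro density_set_sphere_const[OF A ij _ _ mass(2)[OF eq] that]) auto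
        then show False
          using spherically_symmetric_density_set[OF schur2_convex_sets[OF A]] nonsph by blast
      qed
    qed
  qed (auto simp: R_def)
  then show ?thesis
    using assms(3,4) by (simp add: R_def strictly_majorizes_def)
qed

section \<open>From Gaussian integrals to probabilities\<close>

lemma std_normal_density_prod:
  fixes z :: "real^'n"
  shows "(\<Prod>i\<in>UNIV. std_normal_density (z $ i)) = (1 / sqrt (2 * pi)) ^ CARD('n) * gauss z"
proof -
  have "(norm z)\<^sup>2 = (\<Sum>i\<in>UNIV. (z $ i)\<^sup>2)"
    by (simp add: norm_vec_def L2_set_def sum_nonneg)
  then have "gauss z = (\<Prod>i\<in>UNIV. exp (- (z $ i)\<^sup>2 / 2))"
    by (simp add: gauss_def exp_sum sum_divide_distrib flip: sum_negf)
  then show ?thesis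
    by (simp add: std_normal_density_def prod.distrib prod_dividef power_divide)
qed

lemma borel_version:
  assumes "A \<in> sets (completion M)"
  obtains B where "B \<in> sets M" "AE x in M. x \<in> A \<longleftrightarrow> x \<in> B"
proof
  show "main_part M A \<in> sets M"
    using assms by simp
  have "A = main_part M A \<union> null_part M A"
    using assms by simp
  then show "AE x in M. x \<in> A \<longleftrightarrow> x \<in> main_part M A"
    using AE_notin_null_part[OF assms] by (auto elim!: eventually_mono)
qed

text \<open>\<open>A\<close> is replaced by a Borel set \<open>B\<close> that agrees with it almost
  everywhere. Because \<open>Z\<close> has a density, the exceptional set pulls back to a null set
  of \<open>M\<close>, so the event in the completion has the probability of a Borel event.\<close>

lemma shifted_prob_gauss_mass:
  fixes Z :: "'w \<Rightarrow> real^'n"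
  defines "\<kappa> \<equiv> (1 / sqrt (2 * pi)) ^ CARD('n)"
  assumes N: "standard_normal M Z" and A: "A \<in> sets lebesgue"
  shows "shifted_prob M Z A x = ennreal (\<kappa> * gauss_mass A x)"
    and "(\<lambda>x. ennreal (\<kappa> * gauss_mass A x)) \<in> borel_measurable borel"
proof -
  have \<kappa>: "0 \<le> \<kappa>" by (simp add: \<kappa>_def)
  have dist: "distributed M lborel Z (\<lambda>z. ennreal (\<kappa> * gauss z))"
    using N unfolding standard_normal_def std_normal_density_prod \<kappa>_def .
  have Zm: "Z \<in> M \<rightarrow>\<^sub>M lborel"
    using dist by (rule distributed_measurable)
  obtain B where B: "B \<in> sets lborel" "AE z in lborel. z \<in> A \<longleftrightarrow> z \<in> B"
    using borel_version[OF A] by blast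
  then have [measurable]: "B \<in> sets borel" by simp
  have mass: "ennreal (\<kappa> * gauss_mass A x) = (\<integral>\<^sup>+z. ennreal (\<kappa> * gauss (z + x)) * indicator B z \<partial>lborel)" for x
  proof -
    have "ennreal (\<kappa> * gauss_mass A x) = ennreal (\<integral>z. \<kappa> * (indicator A z * gauss (z + x)) \<partial>lebesgue)"
      by (simp add: gauss_mass_def)
    also have "\<dots> = (\<integral>\<^sup>+z. ennreal (\<kappa> * (indicator A z * gauss (z + x))) \<partial>lebesgue)"
      by (intro nn_integral_eq_integral[symmetric] integrable_mult_right integrable_gauss_mass A)
         (simp add: \<kappa> less_imp_le[OF gauss_pos])
    also have "\<dots> = (\<integral>\<^sup>+z. ennreal (\<kappa> * (indicator A z * gauss (z + x))) \<partial>lborel)"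
      by (rule nn_integral_completion)
    also have "\<dots> = (\<integral>\<^sup>+z. ennreal (\<kappa> * gauss (z + x)) * indicator B z \<partial>lborel)"
      using B(2) by (intro nn_integral_cong_AE) (auto elim!: eventually_mono simp: indicator_def)
    finally show ?thesis .
  qed
  \<comment> \<open>With \<open>B\<close> Borel, the integrand in \<open>mass\<close> is jointly
    measurable in \<open>x\<close> and \<open>z\<close>.\<close>
  show "(\<lambda>x. ennreal (\<kappa> * gauss_mass A x)) \<in> borel_measurable borel"
    unfolding mass by measurable
  define B' where "B' = {z. z - x \<in> B}"
  have B': "B' \<in> sets lborel"
    unfolding B'_def by measurable
  have "AE z in distr lborel borel ((+) (- x)). z \<in> A \<longleftrightarrow> z \<in> B"
    using B(2) by (simp only: lborel_distr_plus)
  then have "AE z in lborel. - x + z \<in> A \<longleftrightarrow> - x + z \<in> B"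
    by (rule AE_distrD[rotated]) simp
  then have "AE z in lborel. z \<in> (\<lambda>a. a + x) ` A \<longleftrightarrow> z \<in> B'"
  proof (rule eventually_mono)
    fix z assume "- x + z \<in> A \<longleftrightarrow> - x + z \<in> B"
    moreover have "z \<in> (\<lambda>a. a + x) ` A \<longleftrightarrow> - x + z \<in> A"
      by (auto simp: image_iff intro: bexI[of _ "- x + z"])
    ultimately show "z \<in> (\<lambda>a. a + x) ` A \<longleftrightarrow> z \<in> B'"
      by (simp add: B'_def)
  qed
  then have "AE z in density lborel (\<lambda>z. ennreal (\<kappa> * gauss z)). z \<in> (\<lambda>a. a + x) ` A \<longleftrightarrow> z \<in> B'"
    using distributed_borel_measurable[OF dist] by (subst AE_density) (auto elim: eventually_mono)
  then have "AE z in distr M lborel Z. z \<in> (\<lambda>a. a + x) ` A \<longleftrightarrow> z \<in> B'"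
    unfolding distributed_distr_eq_density[OF dist] .
  then have "AE w in M. Z w \<in> (\<lambda>a. a + x) ` A \<longleftrightarrow> Z w \<in> B'"
    by (rule AE_distrD[OF Zm])
  then have ae: "AE w in completion M. Z w \<in> (\<lambda>a. a + x) ` A \<longleftrightarrow> Z w \<in> B'"
    by (rule AE_completion)
  have ZB': "Z -` B' \<inter> space M \<in> sets M"
    using measurable_sets[OF Zm B'] .
  have "shifted_prob M Z A x = emeasure (completion M) (Z -` B' \<inter> space M)"
    unfolding shifted_prob_def
    using ae shifted_event_measurable[OF N A, of x] ZB'
    by (intro emeasure_eq_AE) (auto elim: eventually_mono simp del: emeasure_completion)
  also have "\<dots> = emeasure M (Z -` B' \<inter> space M)"
    using ZB' by simp
  also have "\<dots> = (\<integral>\<^sup>+z. ennreal (\<kappa> * gauss z) * indicator B' z \<partial>lborel)"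
    by (rule distributed_emeasure[OF dist B'])
  also have "\<dots> = (\<integral>\<^sup>+z. ennreal (\<kappa> * gauss (z + x)) * indicator B' (z + x) \<partial>lborel)"
    using B' by (intro nn_integral_lborel_shift[symmetric]) simp
  also have "\<dots> = ennreal (\<kappa> * gauss_mass A x)"
    unfolding mass by (simp add: B'_def indicator_def)
  finally show "shifted_prob M Z A x = ennreal (\<kappa> * gauss_mass A x)" .
qed

theorem corollary2p4:
  fixes M :: "'w measure" and Z :: "'w \<Rightarrow> real^'n" and A :: "(real^'n) set"
    and P :: "real^'n \<Rightarrow> ennreal"
  assumes "prob_space M"
    and "standard_normal M Z"
    and "schur2_convex A"
    and "P = shifted_prob M Z A"
  shows "schur2_concave P \<and>
    (\<not> (\<exists>B. spherically_symmetric B \<and> equivalent_sets A B) \<longrightarrow> strictly_schur2_concave P)"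
proof -
  note A = assms(3)
  define \<kappa> :: real where "\<kappa> = (1 / sqrt (2 * pi)) ^ CARD('n)"
  have \<kappa>: "0 < \<kappa>" by (simp add: \<kappa>_def)
  have P: "P x = ennreal (\<kappa> * gauss_mass A x)" for x
    using shifted_prob_gauss_mass(1)[OF assms(2) schur2_convex_sets[OF A]]
    by (simp add: assms(4) \<kappa>_def)
  have "P \<in> borel_measurable borel"
    using shifted_prob_gauss_mass(2)[OF assms(2) schur2_convex_sets[OF A]]
    by (simp add: P[abs_def] \<kappa>_def)
  then have meas: "P \<in> borel_measurable lebesgue"
    by (intro measurable_completion) simp
  \<comment> \<open>Here \<open>x\<close> is compared with its vector of absolute values;
    consequently \<open>P\<close> composed with \<open>vec_sqrt\<close> serves as the function
    \<open>g\<close> on the orthant.\<close>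
  have "gauss_mass A (vec_sqrt (vec_square x)) = gauss_mass A x" for x
    by (rule gauss_mass_permuted[OF A bij_id]) (simp add: vec_sqrt_def vec_square_def)
  then have g: "P x = P (vec_sqrt (vec_square x))" for x
    by (simp add: P)
  have "schur_concave_on nonneg_orthant (\<lambda>a. P (vec_sqrt a))"
    using gauss_mass_schur_concave[OF A] \<kappa>
    by (simp add: schur_concave_on_def P ennreal_leI)
  then have "schur2_concave P"
    unfolding schur2_concave_def using meas g by (intro conjI exI[of _ "\<lambda>a. P (vec_sqrt a)"]) auto
  moreover have "strictly_schur2_concave P"
    if nonsph: "\<not> (\<exists>B. spherically_symmetric B \<and> equivalent_sets A B)"
  proof -
    have "strictly_schur_concave_on nonneg_orthant (\<lambda>a. P (vec_sqrt a))"
      using gauss_mass_strictly_schur_concave[OF A nonsph] \<kappa>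
      by (auto simp: strictly_schur_concave_on_def P ennreal_less_iff gauss_mass_nonneg)
    then show ?thesis
      unfolding strictly_schur2_concave_def using meas g
      by (intro conjI exI[of _ "\<lambda>a. P (vec_sqrt a)"]) auto
  qed
  ultimately show ?thesis by blast
qed

end
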